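(* Let $\mu(\mathfrak g)$ denote the least $N$ such that the real Lie algebra $\mathfrak g$ has a faithful representation in $\mathfrak{gl}(N,\mathbb R)$. Let $L_{8.5}=\mathfrak{so}(3)\ltimes\mathbb R^5$, where $\mathbb R^5$ is an abelian ideal on which $\mathfrak{so}(3)$ acts by its irreducible five-dimensional real representation, and let $L_{8.21}=\mathfrak{sl}(2,\mathbb R)\ltimes\mathbb R^5$, where $\mathbb R^5$ is an abelian ideal on which $\mathfrak{sl}(2,\mathbb R)$ acts by its irreducible five-dimensional representation. Then $\mu(L_{8.5})=\mu(L_{8.21})=6$.
   Context: Concretely, $L_{8.5}$ and $L_{8.21}$ are isomorphic to the real Lie algebras (under the commutator) of all matrices of the respective forms, with $a,\dots,h\in\mathbb R$: $$\begin{pmatrix}0&2c&4b&4a&0&d\\-2c&0&-4a&4b&0&e\\-b&a&0&c&-6a&f\\-a&-b&-c&0&-6b&g\\0&0&2a&2b&0&h\\0&0&0&0&0&0\end{pmatrix},\qquad \begin{pmatrix}4a&4b&0&0&0&d\\c&2a&3b&0&0&e\\0&2c&0&2b&0&f\\0&0&3c&-2a&b&g\\0&0&0&4c&-4a&h\\0&0&0&0&0&0\end{pmatrix}.$$ *)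

theory Defs
  imports "HOL-Analysis.Analysis" "Jordan_Normal_Form.Matrix"
begin

(* leaves "$" to the Euclidean vectors of HOL-Analysis *)
no_notation vec_index (infixl "$" 100)

text \<open>
  A real Lie algebra is given by a linear subspace \<open>g\<close> of an ambient real vector space together
  with a bracket, of which only the values on \<open>g\<close> matter.
\<close>

definition lie_algebra :: "'a::real_vector set \<Rightarrow> ('a \<Rightarrow> 'a \<Rightarrow> 'a) \<Rightarrow> bool" where
  "lie_algebra g br \<longleftrightarrow>
     subspace g \<and>
     (\<forall>x\<in>g. \<forall>y\<in>g. br x y \<in> g) \<and>
     (\<forall>x\<in>g. \<forall>y\<in>g. \<forall>z\<in>g. br (x + y) z = br x z + br y z) \<and>
     (\<forall>x\<in>g. \<forall>y\<in>g. \<forall>z\<in>g. br x (y + z) = br x y + br x z) \<and>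
     (\<forall>c. \<forall>x\<in>g. \<forall>y\<in>g. br (c *\<^sub>R x) y = c *\<^sub>R br x y) \<and>
     (\<forall>c. \<forall>x\<in>g. \<forall>y\<in>g. br x (c *\<^sub>R y) = c *\<^sub>R br x y) \<and>
     (\<forall>x\<in>g. br x x = 0) \<and>
     (\<forall>x\<in>g. \<forall>y\<in>g. \<forall>z\<in>g. br x (br y z) + br y (br z x) + br z (br x y) = 0)"

text \<open>
  Since \<open>N\<close> varies, \<open>gl(N, \<real>)\<close> is taken to be \<^term>\<open>carrier_mat N N\<close> (over the reals) with the
  commutator.
\<close>

definition faithful_matrix_rep ::
    "'a::real_vector set \<Rightarrow> ('a \<Rightarrow> 'a \<Rightarrow> 'a) \<Rightarrow> nat \<Rightarrow> ('a \<Rightarrow> real Matrix.mat) \<Rightarrow> bool" where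
  "faithful_matrix_rep g br N \<rho> \<longleftrightarrow>
     (\<forall>x\<in>g. \<rho> x \<in> carrier_mat N N) \<and>
     (\<forall>x\<in>g. \<forall>y\<in>g. \<rho> (x + y) = \<rho> x + \<rho> y) \<and>
     (\<forall>c. \<forall>x\<in>g. \<rho> (c *\<^sub>R x) = c \<cdot>\<^sub>m \<rho> x) \<and>
     (\<forall>x\<in>g. \<forall>y\<in>g. \<rho> (br x y) = \<rho> x * \<rho> y - \<rho> y * \<rho> x) \<and>
     inj_on \<rho> g"

definition mu :: "'a::real_vector set \<Rightarrow> ('a \<Rightarrow> 'a \<Rightarrow> 'a) \<Rightarrow> nat" where
  "mu g br = (LEAST N. \<exists>\<rho>. faithful_matrix_rep g br N \<rho>)"

definition lie_rep ::
    "'a::real_vector set \<Rightarrow> ('a \<Rightarrow> 'a \<Rightarrow> 'a) \<Rightarrow> ('a \<Rightarrow> 'v::real_vector \<Rightarrow> 'v) \<Rightarrow> bool" where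
  "lie_rep g br \<phi> \<longleftrightarrow>
     (\<forall>x\<in>g. linear (\<phi> x)) \<and>
     (\<forall>x\<in>g. \<forall>y\<in>g. \<forall>v. \<phi> (x + y) v = \<phi> x v + \<phi> y v) \<and>
     (\<forall>c. \<forall>x\<in>g. \<forall>v. \<phi> (c *\<^sub>R x) v = c *\<^sub>R \<phi> x v) \<and>
     (\<forall>x\<in>g. \<forall>y\<in>g. \<forall>v. \<phi> (br x y) v = \<phi> x (\<phi> y v) - \<phi> y (\<phi> x v))"

definition irreducible_lie_rep ::
    "'a::real_vector set \<Rightarrow> ('a \<Rightarrow> 'a \<Rightarrow> 'a) \<Rightarrow> ('a \<Rightarrow> 'v::real_vector \<Rightarrow> 'v) \<Rightarrow> bool" where
  "irreducible_lie_rep g br \<phi> \<longleftrightarrow>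
     lie_rep g br \<phi> \<and> (UNIV :: 'v set) \<noteq> {0} \<and>
     (\<forall>S. subspace S \<and> (\<forall>x\<in>g. \<phi> x ` S \<subseteq> S) \<longrightarrow> S = {0} \<or> S = UNIV)"

text \<open>
  The bracket of the semidirect product of \<open>g\<close> with the abelian ideal \<open>'v\<close>, on which \<open>g\<close> acts
  by \<open>\<phi>\<close>; its underlying space is \<open>g \<times> UNIV\<close>.
\<close>

definition semidirect_bracket ::
    "('a \<Rightarrow> 'a \<Rightarrow> 'a) \<Rightarrow> ('a \<Rightarrow> 'v::real_vector \<Rightarrow> 'v) \<Rightarrow> 'a \<times> 'v \<Rightarrow> 'a \<times> 'v \<Rightarrow> 'a \<times> 'v" where
  "semidirect_bracket br \<phi> p q =
     (br (fst p) (fst q), \<phi> (fst p) (snd q) - \<phi> (fst q) (snd p))"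

definition commutator :: "real^'n^'n \<Rightarrow> real^'n^'n \<Rightarrow> real^'n^'n" where
  "commutator A B = A ** B - B ** A"

definition so3 :: "(real^3^3) set" where
  "so3 = {A. Finite_Cartesian_Product.transpose A = - A}"

definition sl2 :: "(real^2^2) set" where
  "sl2 = {A. trace A = 0}"

lemma lie_algebra_commutator:
  fixes g :: "(real^'n^'n) set"
  assumes "subspace g" "\<And>A B. A \<in> g \<Longrightarrow> B \<in> g \<Longrightarrow> commutator A B \<in> g"
  shows "lie_algebra g commutator"
proof -
  have l: "A ** (B - C) = A ** B - A ** C" and r: "(B - C) ** A = B ** A - C ** A"
    and ra: "(B + C) ** A = B ** A + C ** A" for A B C :: "real^'n^'n"
    by (simp_all add: Finite_Cartesian_Product.vec_eq_iff matrix_matrix_mult_def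
        algebra_simps sum.distrib sum_subtractf)
  have s: "(c *\<^sub>R A) ** B = c *\<^sub>R (A ** B)" "A ** (c *\<^sub>R B) = c *\<^sub>R (A ** B)"
    for c and A B :: "real^'n^'n"
    by (simp_all add: Finite_Cartesian_Product.vec_eq_iff matrix_matrix_mult_def
        sum_distrib_left mult_ac)
  show ?thesis
    using assms unfolding lie_algebra_def
    by (simp add: commutator_def l r s ra matrix_add_ldistrib
        matrix_mul_assoc scaleR_diff_right)
qed

lemma so3_iff:
  "A \<in> so3 \<longleftrightarrow> A $ 1 $ 1 = 0 \<and> A $ 2 $ 2 = 0 \<and> A $ 3 $ 3 = 0 \<and>
     A $ 1 $ 2 = - (A $ 2 $ 1) \<and> A $ 3 $ 1 = - (A $ 1 $ 3) \<and> A $ 2 $ 3 = - (A $ 3 $ 2)"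
  by (auto simp: so3_def Finite_Cartesian_Product.transpose_def
      Finite_Cartesian_Product.vec_eq_iff forall_3)

lemma sl2_iff: "A \<in> sl2 \<longleftrightarrow> A $ 2 $ 2 = - (A $ 1 $ 1)"
  by (auto simp: sl2_def trace_def sum_2)

lemma lie_algebra_so3: "lie_algebra so3 commutator"
proof (rule lie_algebra_commutator)
  show "subspace so3"
    by (simp add: subspace_def so3_iff)
  show "commutator A B \<in> so3" if "A \<in> so3" "B \<in> so3" for A B
    using that by (simp add: so3_iff commutator_def matrix_matrix_mult_def sum_3)
qed

lemma lie_algebra_sl2: "lie_algebra sl2 commutator"
proof (rule lie_algebra_commutator)
  show "subspace sl2"
    by (simp add: subspace_def sl2_iff)
  show "commutator A B \<in> sl2" if "A \<in> sl2" "B \<in> sl2" for A B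
    using that by (simp add: sl2_iff commutator_def matrix_matrix_mult_def sum_2)
qed

lemma lie_algebra_semidirect:
  fixes \<phi> :: "'a::real_vector \<Rightarrow> 'v::real_vector \<Rightarrow> 'v"
  assumes g: "lie_algebra g br" and rep: "lie_rep g br \<phi>"
  shows "lie_algebra (g \<times> UNIV) (semidirect_bracket br \<phi>)"
proof -
  have "subspace (g \<times> (UNIV :: 'v set))"
    using g by (intro subspace_Times) (auto simp: lie_algebra_def)
  moreover have "\<phi> x (v + w) = \<phi> x v + \<phi> x w" "\<phi> x (v - w) = \<phi> x v - \<phi> x w"
      "\<phi> x (c *\<^sub>R v) = c *\<^sub>R \<phi> x v" if "x \<in> g" for x v w c
    using rep that unfolding lie_rep_def by (blast intro: linear_add linear_diff linear_cmul)+
  ultimately show ?thesis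
    using g rep unfolding lie_algebra_def lie_rep_def
    by (intro conjI ballI allI;
        clarsimp simp: semidirect_bracket_def scaleR_diff_right zero_prod_def)
qed

text \<open>
  The irreducible five-dimensional representations exist, so that speaking about all of them
  is not vacuous.
\<close>

lemma exhaust_5: "x = 1 \<or> x = 2 \<or> x = 3 \<or> x = 4 \<or> x = 5" for x :: 5
proof (induct x)
  case (of_int z)
  then have "0 \<le> z" "z < 5" by simp_all
  then have "z = 0 \<or> z = 1 \<or> z = 2 \<or> z = 3 \<or> z = 4" by arith
  then show ?case by auto
qed

lemma forall_5: "(\<forall>i::5. P i) \<longleftrightarrow> P 1 \<and> P 2 \<and> P 3 \<and> P 4 \<and> P 5"
  by (metis exhaust_5)

definition vec5 :: "real \<Rightarrow> real \<Rightarrow> real \<Rightarrow> real \<Rightarrow> real \<Rightarrow> real^5" where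
  "vec5 p q r s t =
     (\<chi> i. if i = 1 then p else if i = 2 then q else if i = 3 then r else if i = 4 then s else t)"

lemma vec5_nth [simp]:
  "vec5 p q r s t $ 1 = p" "vec5 p q r s t $ 2 = q" "vec5 p q r s t $ 3 = r"
  "vec5 p q r s t $ 4 = s" "vec5 p q r s t $ 5 = t"
  by (simp_all add: vec5_def)

lemma vec5_eqI:
  fixes v w :: "real^5"
  assumes "v $ 1 = w $ 1" "v $ 2 = w $ 2" "v $ 3 = w $ 3" "v $ 4 = w $ 4" "v $ 5 = w $ 5"
  shows "v = w"
  using assms by (simp add: Finite_Cartesian_Product.vec_eq_iff forall_5)

lemma subspace_UNIV_vec5:
  assumes S: "subspace S"
    and e: "vec5 1 0 0 0 0 \<in> S" "vec5 0 1 0 0 0 \<in> S" "vec5 0 0 1 0 0 \<in> S"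
      "vec5 0 0 0 1 0 \<in> S" "vec5 0 0 0 0 1 \<in> S"
  shows "S = UNIV"
proof -
  have "v \<in> S" for v
  proof -
    have "v = (v $ 1) *\<^sub>R vec5 1 0 0 0 0 + (v $ 2) *\<^sub>R vec5 0 1 0 0 0
      + (v $ 3) *\<^sub>R vec5 0 0 1 0 0 + (v $ 4) *\<^sub>R vec5 0 0 0 1 0 + (v $ 5) *\<^sub>R vec5 0 0 0 0 1"
      by (rule vec5_eqI) simp_all
    moreover have "\<dots> \<in> S" using S e by (intro subspace_add subspace_scale)
    ultimately show ?thesis by simp
  qed
  then show ?thesis by auto
qed

lemma subspace_mem_multiple:
  assumes "subspace S" "u \<in> S" "u = c *\<^sub>R w" "c \<noteq> (0::real)"
  shows "w \<in> S"
proof -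
  have "w = inverse c *\<^sub>R u" using assms(3,4) by simp
  then show ?thesis using subspace_scale[OF assms(1,2)] by simp
qed

definition sl2_act :: "real^2^2 \<Rightarrow> real^5 \<Rightarrow> real^5" where
  "sl2_act A v = (let a = A $ 1 $ 1; b = A $ 1 $ 2; c = A $ 2 $ 1 in
     vec5 (4 * a * v $ 1 + 4 * b * v $ 2)
          (c * v $ 1 + 2 * a * v $ 2 + 3 * b * v $ 3)
          (2 * c * v $ 2 + 2 * b * v $ 4)
          (3 * c * v $ 3 - 2 * a * v $ 4 + b * v $ 5)
          (4 * c * v $ 4 - 4 * a * v $ 5))"

definition so3_act :: "real^3^3 \<Rightarrow> real^5 \<Rightarrow> real^5" where
  "so3_act A v = (let a = - (A $ 3 $ 2) / 2; b = - (A $ 1 $ 3) / 2; c = - (A $ 2 $ 1) in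
     vec5 (2 * c * v $ 2 + 4 * b * v $ 3 + 4 * a * v $ 4)
          (- 2 * c * v $ 1 - 4 * a * v $ 3 + 4 * b * v $ 4)
          (- b * v $ 1 + a * v $ 2 + c * v $ 4 - 6 * a * v $ 5)
          (- a * v $ 1 - b * v $ 2 - c * v $ 3 - 6 * b * v $ 5)
          (2 * a * v $ 3 + 2 * b * v $ 4))"

lemma lie_rep_sl2_act: "lie_rep sl2 commutator sl2_act"
proof -
  have "linear (sl2_act A)" for A
    by (intro linearI vec5_eqI) (simp_all add: sl2_act_def Let_def algebra_simps)
  moreover have "sl2_act (A + B) v = sl2_act A v + sl2_act B v"
      "sl2_act (c *\<^sub>R A) v = c *\<^sub>R sl2_act A v" for A B v c
    by (intro vec5_eqI; simp add: sl2_act_def Let_def algebra_simps)+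
  moreover have "sl2_act (commutator A B) v = sl2_act A (sl2_act B v) - sl2_act B (sl2_act A v)"
    if "A \<in> sl2" "B \<in> sl2" for A B v
  proof -
    show ?thesis
      using that by (intro vec5_eqI) (simp_all add: sl2_act_def Let_def commutator_def
          matrix_matrix_mult_def sum_2 sl2_iff algebra_simps)
  qed
  ultimately show ?thesis by (simp add: lie_rep_def)
qed

lemma lie_rep_so3_act: "lie_rep so3 commutator so3_act"
proof -
  have "linear (so3_act A)" for A
    by (intro linearI vec5_eqI) (simp_all add: so3_act_def Let_def algebra_simps)
  moreover have "so3_act (A + B) v = so3_act A v + so3_act B v"
      "so3_act (c *\<^sub>R A) v = c *\<^sub>R so3_act A v" for A B v c
    by (intro vec5_eqI; simp add: so3_act_def Let_def field_simps)+
  moreover have "so3_act (commutator A B) v = so3_act A (so3_act B v) - so3_act B (so3_act A v)"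
    if "A \<in> so3" "B \<in> so3" for A B v
  proof -
    show ?thesis
      using that by (intro vec5_eqI) (simp_all add: so3_act_def Let_def commutator_def
          matrix_matrix_mult_def sum_3 so3_iff field_simps)
  qed
  ultimately show ?thesis by (simp add: lie_rep_def)
qed

lemma irreducible_sl2_act: "irreducible_lie_rep sl2 commutator sl2_act"
proof -
  have "S = UNIV" if S: "subspace S" and inv: "\<forall>A\<in>sl2. sl2_act A ` S \<subseteq> S" and "S \<noteq> {0}" for S
  proof -
    obtain v where v: "v \<in> S" "v \<noteq> 0"
      using S \<open>S \<noteq> {0}\<close> subspace_0 by blast
    define E F where "E = sl2_act (\<chi> i j. if i = 1 \<and> j = 2 then 1 else 0)"
      and "F = sl2_act (\<chi> i j. if i = 2 \<and> j = 1 then 1 else 0)"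
    have E: "E w = vec5 (4 * w $ 2) (3 * w $ 3) (2 * w $ 4) (w $ 5) 0"
      and F: "F w = vec5 0 (w $ 1) (2 * w $ 2) (3 * w $ 3) (4 * w $ 4)" for w
      by (simp_all add: E_def F_def sl2_act_def)
    have ES: "E w \<in> S" and FS: "F w \<in> S" if "w \<in> S" for w
      using inv that by (auto simp: E_def F_def sl2_iff image_subset_iff)
    note ES1 = ES[OF v(1)]
    note ES2 = ES[OF ES1]
    note ES3 = ES[OF ES2]
    note ES4 = ES[OF ES3]
    note mult = subspace_mem_multiple[OF S]
    have e1: "vec5 1 0 0 0 0 \<in> S"
    proof (cases "v $ 5 = 0")
      case False
      then show ?thesis
        by - (rule mult[OF ES4, of "24 * v $ 5", OF vec5_eqI], simp_all add: E)
    next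
      case v5: True
      show ?thesis
      proof (cases "v $ 4 = 0")
        case False
        then show ?thesis
          by - (rule mult[OF ES3, of "24 * v $ 4", OF vec5_eqI], simp_all add: E v5)
      next
        case v4: True
        show ?thesis
        proof (cases "v $ 3 = 0")
          case False
          then show ?thesis
            by - (rule mult[OF ES2, of "12 * v $ 3", OF vec5_eqI], simp_all add: E v4 v5)
        next
          case v3: True
          show ?thesis
          proof (cases "v $ 2 = 0")
            case False
            then show ?thesis
              by - (rule mult[OF ES1, of "4 * v $ 2", OF vec5_eqI], simp_all add: E v3 v4 v5)
          next
            case v2: True
            then have "v $ 1 \<noteq> 0"
              using v(2) v3 v4 v5 by (auto simp: Finite_Cartesian_Product.vec_eq_iff forall_5)
            then show ?thesis
              by - (rule mult[OF v(1), of "v $ 1", OF vec5_eqI], simp_all add: v2 v3 v4 v5)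
          qed
        qed
      qed
    qed
    have e2: "vec5 0 1 0 0 0 \<in> S"
      by (rule mult[OF FS[OF e1], of 1]) (auto intro!: vec5_eqI simp: F)
    have e3: "vec5 0 0 1 0 0 \<in> S"
      by (rule mult[OF FS[OF e2], of 2]) (auto intro!: vec5_eqI simp: F)
    have e4: "vec5 0 0 0 1 0 \<in> S"
      by (rule mult[OF FS[OF e3], of 3]) (auto intro!: vec5_eqI simp: F)
    have e5: "vec5 0 0 0 0 1 \<in> S"
      by (rule mult[OF FS[OF e4], of 4]) (auto intro!: vec5_eqI simp: F)
    show ?thesis using subspace_UNIV_vec5[OF S e1 e2 e3 e4 e5] .
  qed
  moreover have "(UNIV :: (real^5) set) \<noteq> {0}"
    by (metis UNIV_I singletonD vec5_nth(1) zero_index zero_neq_one)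
  ultimately show ?thesis
    using lie_rep_sl2_act unfolding irreducible_lie_rep_def by blast
qed

lemma irreducible_so3_act: "irreducible_lie_rep so3 commutator so3_act"
proof -
  have "S = UNIV" if S: "subspace S" and inv: "\<forall>A\<in>so3. so3_act A ` S \<subseteq> S" and "S \<noteq> {0}" for S
  proof -
    obtain v where v: "v \<in> S" "v \<noteq> 0"
      using S \<open>S \<noteq> {0}\<close> subspace_0 by blast
    define X where "X = so3_act (\<chi> i j. if i = 3 \<and> j = 2 then - 2 else if i = 2 \<and> j = 3 then 2 else 0)"
    define Y where "Y = so3_act (\<chi> i j. if i = 1 \<and> j = 3 then - 2 else if i = 3 \<and> j = 1 then 2 else 0)"
    define Z where "Z = so3_act (\<chi> i j. if i = 2 \<and> j = 1 then - 1 else if i = 1 \<and> j = 2 then 1 else 0)"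
    have X: "X w = vec5 (4 * w $ 4) (- 4 * w $ 3) (w $ 2 - 6 * w $ 5) (- (w $ 1)) (2 * w $ 3)"
      and Y: "Y w = vec5 (4 * w $ 3) (4 * w $ 4) (- (w $ 1)) (- (w $ 2) - 6 * w $ 5) (2 * w $ 4)"
      and Z: "Z w = vec5 (2 * w $ 2) (- 2 * w $ 1) (w $ 4) (- (w $ 3)) 0" for w
      by (simp_all add: X_def Y_def Z_def so3_act_def)
    have XS: "X w \<in> S" and YS: "Y w \<in> S" and ZS: "Z w \<in> S" if "w \<in> S" for w
      using inv that by (auto simp: X_def Y_def Z_def so3_iff image_subset_iff)
    note mult = subspace_mem_multiple[OF S]
    have *: "vec5 0 0 0 0 1 \<in> S" if "w \<in> S" "w $ 5 \<noteq> 0" for w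
    proof (rule mult)
      show "Z (Z (Z (Z w))) + 5 *\<^sub>R Z (Z w) + 4 *\<^sub>R w \<in> S"
        by (intro subspace_add[OF S] subspace_scale[OF S] ZS that(1))
      show "Z (Z (Z (Z w))) + 5 *\<^sub>R Z (Z w) + 4 *\<^sub>R w = (4 * w $ 5) *\<^sub>R vec5 0 0 0 0 1"
        by (rule vec5_eqI) (simp_all add: Z)
      show "4 * w $ 5 \<noteq> 0" using that(2) by simp
    qed
    have **: "vec5 0 0 0 0 1 \<in> S" if "w \<in> S" "w $ 3 \<noteq> 0 \<or> w $ 4 \<noteq> 0" for w
      using *[OF XS[OF that(1)]] *[OF YS[OF that(1)]] that(2) by (auto simp: X Y)
    have e5: "vec5 0 0 0 0 1 \<in> S"
    proof (cases "v $ 5 = 0 \<and> v $ 3 = 0 \<and> v $ 4 = 0")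
      case False
      then show ?thesis using *[OF v(1)] **[OF v(1)] by blast
    next
      case True
      then have "v $ 1 \<noteq> 0 \<or> v $ 2 \<noteq> 0"
        using v(2) by (auto simp: Finite_Cartesian_Product.vec_eq_iff forall_5)
      then show ?thesis using **[OF XS[OF v(1)]] True by (auto simp: X)
    qed
    have e3: "vec5 0 0 1 0 0 \<in> S"
      by (rule mult[OF XS[OF e5], of "- 6"]) (auto intro!: vec5_eqI simp: X)
    have e4: "vec5 0 0 0 1 0 \<in> S"
      by (rule mult[OF YS[OF e5], of "- 6"]) (auto intro!: vec5_eqI simp: Y)
    have e1: "vec5 1 0 0 0 0 \<in> S"
      by (rule mult[OF YS[OF e3], of 4]) (auto intro!: vec5_eqI simp: Y)
    have e2: "vec5 0 1 0 0 0 \<in> S"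
      by (rule mult[OF subspace_diff[OF S YS[OF e4] subspace_scale[OF S e5, of 2]], of 4])
        (auto intro!: vec5_eqI simp: Y)
    show ?thesis using subspace_UNIV_vec5[OF S e1 e2 e3 e4 e5] .
  qed
  moreover have "(UNIV :: (real^5) set) \<noteq> {0}"
    by (metis UNIV_I singletonD vec5_nth(1) zero_index zero_neq_one)
  ultimately show ?thesis
    using lie_rep_so3_act unfolding irreducible_lie_rep_def by blast
qed

end

(*
The semidirect product g |x V acts on V + R, of dimension 6, by affine maps; this is faithful because g
is simple and acts nontrivially on V.

Suppose that g |x V acts faithfully on W = R^5. Since V = [g, V] and V is abelian, V is spanned by
elements that act nilpotently (Jacobson's lemma), so V kills a nonzero vector in every nonzero quotient
of W by an invariant subspace. Let K be the common kernel of V on W and K2 the preimage of the common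
kernel on W/K. As V is irreducible it embeds into Hom(K2/K, K), and 5 = dim V forces
{dim K, dim K2/K} = {2, 3} and K2 = W. So V is an invariant hyperplane of the 6-dimensional space
K (x) (W/K)^*, given by the vanishing of an invariant bilinear form on K x (W/K)^*, and the radical of
this form on the 3-dimensional factor is nonzero. Irreducibility makes V the tensor product of that
radical with the 2-dimensional factor, so that dim V would be even.
*)
theory Submission imports Defs begin

section \<open>Rank-one matrices and tensor products of subspaces\<close>

definition outer :: "real^'n \<Rightarrow> real^'m \<Rightarrow> real^'m^'n" where
  "outer a b = (\<chi> i j. a $ i * b $ j)"

lemma outer_linear:
  "outer (a + a') b = outer a b + outer a' b" "outer (r *\<^sub>R a) b = r *\<^sub>R outer a b"
  "outer a (b + b') = outer a b + outer a b'" "outer a (r *\<^sub>R b) = r *\<^sub>R outer a b"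
  "outer 0 b = 0" "outer a 0 = 0"
  by (simp_all add: outer_def Finite_Cartesian_Product.vec_eq_iff algebra_simps)

lemma outer_mult_vec: "outer a b *v w = inner b w *\<^sub>R a"
  by (simp add: outer_def Finite_Cartesian_Product.vec_eq_iff matrix_vector_mult_def inner_vec_def
      sum_distrib_left mult_ac)

lemma inner_outer: "inner T (outer a b) = inner a (T *v b)"
  by (simp add: outer_def matrix_vector_mult_def inner_vec_def sum_distrib_left mult_ac)

lemma inner_outer_outer: "inner (outer a b) (outer c d) = inner a c * inner b d"
  by (simp add: inner_outer outer_mult_vec inner_commute)

lemma matrix_mult_outer: "Y ** outer a b = outer (Y *v a) b"
  by (simp add: outer_def Finite_Cartesian_Product.vec_eq_iff matrix_vector_mult_def
      matrix_matrix_mult_def sum_distrib_left mult_ac)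

lemma outer_mult_matrix: "outer a b ** Y = outer a (b v* Y)"
  by (simp add: outer_def Finite_Cartesian_Product.vec_eq_iff vector_matrix_mult_def
      matrix_matrix_mult_def sum_distrib_left mult_ac)

lemma matrix_mult_simps:
  fixes A :: "real^'n^'n"
  shows "A ** (B - C) = A ** B - A ** C" "(B - C) ** A = B ** A - C ** A"
    "A ** (B + C) = A ** B + A ** C" "(B + C) ** A = B ** A + C ** A"
    "(r *\<^sub>R A) ** B = r *\<^sub>R (A ** B)" "A ** (r *\<^sub>R B) = r *\<^sub>R (A ** B)"
    "A ** 0 = 0" "0 ** A = 0"
  by (simp_all add: Finite_Cartesian_Product.vec_eq_iff matrix_matrix_mult_def
      algebra_simps sum.distrib sum_subtractf sum_distrib_left)

lemma linear_commutator_right: "linear (commutator Y)"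
  by (intro linearI) (simp_all add: commutator_def matrix_mult_simps algebra_simps)

lemma commutator_outer: "commutator Y (outer a b) = outer (Y *v a) b - outer a (b v* Y)"
  by (simp add: commutator_def matrix_mult_outer outer_mult_matrix)

text \<open>The tensor product is realised inside a matrix space: a pure tensor is the rank-one
  matrix \<open>outer a b\<close>. The row factor serves as a space of functionals through the inner
  product, so that matrices mapping one subquotient to another become tensors.\<close>

definition tensor :: "(real^'n) set \<Rightarrow> (real^'m) set \<Rightarrow> (real^'m^'n) set" where
  "tensor U E = span {outer a b |a b. a \<in> U \<and> b \<in> E}"

lemma subspace_tensor: "subspace (tensor U E)"
  by (simp add: tensor_def)

lemma outer_in_tensor: "a \<in> U \<Longrightarrow> b \<in> E \<Longrightarrow> outer a b \<in> tensor U E"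
  unfolding tensor_def by (rule span_base) blast

lemma tensor_subset:
  assumes "subspace M" "\<And>a b. a \<in> U \<Longrightarrow> b \<in> E \<Longrightarrow> outer a b \<in> M"
  shows "tensor U E \<subseteq> M"
  unfolding tensor_def by (rule span_minimal) (use assms in auto)

text \<open>By linearity pure tensors suffice, and there \<open>commutator_outer\<close> splits the
  commutator into the action of \<open>Y\<close> on the column factor minus its right action on the
  row factor.\<close>

lemma tensor_commutator:
  assumes "\<And>a. a \<in> U \<Longrightarrow> Y *v a \<in> U" "\<And>b. b \<in> E \<Longrightarrow> b v* Y \<in> E" "A \<in> tensor U E"
  shows "commutator Y A \<in> tensor U E"
proof -
  have "tensor U E \<subseteq> {A. commutator Y A \<in> tensor U E}"
  proof (rule tensor_subset)
    show "subspace {A. commutator Y A \<in> tensor U E}"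
      using linear_subspace_vimage[OF linear_commutator_right subspace_tensor] by (simp add: vimage_def)
  qed (auto simp: commutator_outer intro!: subspace_diff[OF subspace_tensor] outer_in_tensor assms)
  then show ?thesis using assms by blast
qed

text \<open>For the entrywise inner product, the pure tensors of two orthonormal bases are again
  orthonormal. Hence they are pairwise distinct and independent.\<close>

lemma dim_tensor:
  assumes U: "subspace U" and E: "subspace E"
  shows "dim (tensor U E) = dim U * dim E"
proof -
  obtain C where C: "C \<subseteq> U" "pairwise Linear_Algebra.orthogonal C" "\<And>x. x \<in> C \<Longrightarrow> norm x = 1"
    "independent C" "card C = dim U" "span C = U"
    using orthonormal_basis_subspace[OF U] by blast
  obtain B where B: "B \<subseteq> E" "pairwise Linear_Algebra.orthogonal B" "\<And>x. x \<in> B \<Longrightarrow> norm x = 1"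
    "independent B" "card B = dim E" "span B = E"
    using orthonormal_basis_subspace[OF E] by blast
  let ?f = "\<lambda>(c, b). outer c b"
  let ?F = "?f ` (C \<times> B)"
  have ip: "inner (outer c b) (outer c' b') = (if c = c' \<and> b = b' then 1 else 0)"
    if "c \<in> C" "c' \<in> C" "b \<in> B" "b' \<in> B" for c c' b b'
    using that C(2,3) B(2,3)
    by (auto simp: inner_outer_outer pairwise_def Linear_Algebra.orthogonal_def dot_square_norm)
  have inj: "inj_on ?f (C \<times> B)"
  proof (rule inj_onI, clarsimp)
    fix c b c' b' assume *: "c \<in> C" "b \<in> B" "c' \<in> C" "b' \<in> B" "outer c b = outer c' b'"
    show "c = c' \<and> b = b'"
      using ip[of c c' b b'] ip[of c c b b] * by (auto split: if_splits)
  qed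
  have "pairwise Linear_Algebra.orthogonal ?F"
    by (auto simp: pairwise_def Linear_Algebra.orthogonal_def ip split: if_splits)
  moreover have "0 \<notin> ?F"
  proof clarify
    fix c b assume "c \<in> C" "b \<in> B" "0 = outer c b"
    then show False using ip[of c c b b] by simp
  qed
  ultimately have ind: "independent ?F"
    by (rule pairwise_orthogonal_independent)
  have "tensor U E \<subseteq> span ?F"
  proof (rule tensor_subset)
    fix a b assume a: "a \<in> U" and b: "b \<in> E"
    have 1: "outer c b \<in> span ?F" if "c \<in> C" for c
    proof -
      have "b \<in> span B" using b B by simp
      then show ?thesis
      proof (induction rule: span_induct_alt)
        case (step r x y)
        have "outer c x \<in> span ?F" by (rule span_base) (use that step in auto)
        then show ?case using step by (simp add: outer_linear span_add span_scale)
      qed (simp add: outer_linear span_zero)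
    qed
    have "a \<in> span C" using a C by simp
    then show "outer a b \<in> span ?F"
      by (induction rule: span_induct_alt)
        (simp_all add: outer_linear 1 span_add span_scale span_zero)
  qed simp
  moreover have "span ?F \<subseteq> tensor U E"
    by (rule span_minimal[OF _ subspace_tensor]) (use C B in \<open>auto intro!: outer_in_tensor\<close>)
  ultimately have "tensor U E = span ?F" by blast
  then show ?thesis
    using ind inj C(5) B(5) by (simp add: dim_eq_card_independent card_image card_cartesian_product)
qed

section \<open>Invariant hyperplanes in a tensor product\<close>

lemma exists_orthogonal_in_subspace:
  fixes K :: "'a::euclidean_space set"
  assumes K: "subspace K" and F: "F \<subseteq> K" "dim F < dim K"
  obtains x where "x \<in> K" "x \<noteq> 0" "\<And>y. y \<in> F \<Longrightarrow> inner x y = 0"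
proof -
  have "span F \<noteq> span K"
  proof
    assume "span F = span K"
    then have "dim F = dim K" by (metis dim_span)
    then show False using F(2) by simp
  qed
  then have "span F \<subset> span K" using span_mono[OF F(1)] by blast
  from orthogonal_to_subspace_exists_gen[OF this] obtain x where
    "x \<noteq> 0" "x \<in> span K" "\<And>y. y \<in> span F \<Longrightarrow> Linear_Algebra.orthogonal x y" by blast
  then show thesis
    using that[of x] K by (simp add: Linear_Algebra.orthogonal_def span_base span_eq_iff[THEN iffD2])
qed

text \<open>
  The hyperplane is \<open>T\<^sup>\<bottom>\<close>. On the larger of the two factors the form \<open>a \<bullet> T b\<close> has a nonzero
  radical, which is invariant; tensored with the smaller factor it is an invariant subspace of \<open>V\<close>,
  hence all of \<open>V\<close>. But the smaller factor has dimension 2, and 5 is odd.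
\<close>
lemma no_irreducible_hyperplane_in_tensor:
  fixes K :: "(real^'n) set" and E :: "(real^'n) set" and V :: "(real^'n^'n) set"
  assumes K: "subspace K" and E: "subspace E" and V: "subspace V" "V \<subseteq> tensor K E" "dim V = 5"
    and dims: "dim K = 3 \<and> dim E = 2 \<or> dim K = 2 \<and> dim E = 3"
    and inv: "\<And>Y a. Y \<in> G \<Longrightarrow> a \<in> K \<Longrightarrow> Y *v a \<in> K" "\<And>Y b. Y \<in> G \<Longrightarrow> b \<in> E \<Longrightarrow> b v* Y \<in> E"
      "\<And>Y A. Y \<in> G \<Longrightarrow> A \<in> V \<Longrightarrow> commutator Y A \<in> V"
    and irr: "\<And>M. subspace M \<Longrightarrow> M \<subseteq> V \<Longrightarrow> (\<And>Y A. Y \<in> G \<Longrightarrow> A \<in> M \<Longrightarrow> commutator Y A \<in> M)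
      \<Longrightarrow> M = {0} \<or> M = V"
  shows False
proof -
  have d6: "dim (tensor K E) = 6" using dims by (auto simp: dim_tensor K E)
  obtain T where T: "T \<in> tensor K E" "T \<noteq> 0" "\<And>A. A \<in> V \<Longrightarrow> inner T A = 0"
    by (rule exists_orthogonal_in_subspace[OF subspace_tensor V(2)]) (use V(3) d6 in auto)
  let ?H = "{A \<in> tensor K E. inner T A = 0}"
  have H: "subspace ?H"
    by (auto simp: subspace_def inner_add_right subspace_0[OF subspace_tensor]
        intro: subspace_add[OF subspace_tensor] subspace_scale[OF subspace_tensor])
  \<comment> \<open>\<open>?H\<close> omits \<open>T\<close> itself, so it has dimension at most 5;
    it contains \<open>V\<close>, of dimension 5.\<close>
  have "?H = V"
  proof -
    have "T \<notin> ?H" using T(2) by simp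
    then have "?H \<noteq> tensor K E" using T(1) by blast
    then have "dim ?H < 6"
      using d6 H subspace_tensor[of K E]
      by (metis (no_types, lifting) dim_subset mem_Collect_eq order_le_less subsetI subspace_dim_equal)
    then show ?thesis
      using subspace_dim_equal[OF V(1) H] V(2,3) T(3) by auto
  qed
  then have outer_iff: "outer a b \<in> V \<longleftrightarrow> inner a (T *v b) = 0" if "a \<in> K" "b \<in> E" for a b
    using outer_in_tensor[OF that] by (auto simp: inner_outer)
  have nonzero: "outer a b \<noteq> 0" if "a \<noteq> 0" "b \<noteq> 0" for a :: "real^'n" and b :: "real^'n"
    using inner_outer_outer[of a b a b] that by auto
  \<comment> \<open>Irreducibility: an invariant tensor product inside \<open>V\<close> that
    contains a nonzero pure tensor fills \<open>V\<close>.\<close>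
  have Vtensor: "V = tensor K' E'"
    if mem: "\<And>a b. a \<in> K' \<Longrightarrow> b \<in> E' \<Longrightarrow> outer a b \<in> V"
      and iv: "\<And>Y a. Y \<in> G \<Longrightarrow> a \<in> K' \<Longrightarrow> Y *v a \<in> K'" "\<And>Y b. Y \<in> G \<Longrightarrow> b \<in> E' \<Longrightarrow> b v* Y \<in> E'"
      and nz: "a \<in> K'" "a \<noteq> 0" "b \<in> E'" "b \<noteq> 0" for K' E' a b
  proof -
    have "tensor K' E' \<subseteq> V" by (rule tensor_subset[OF V(1) mem])
    then have "tensor K' E' = {0} \<or> tensor K' E' = V"
      by (intro irr subspace_tensor tensor_commutator) (use iv in auto)
    then show ?thesis using nonzero[OF nz(2,4)] outer_in_tensor[OF nz(1,3)] by auto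
  qed
  \<comment> \<open>The commutator of \<open>Y\<close> with an element of \<open>V\<close> stays in
    \<open>V\<close>, so modulo \<open>V\<close> the matrix \<open>Y\<close> may be moved from one
    factor to the other. This makes the radicals below invariant.\<close>
  have comm: "outer (Y *v a) b \<in> V \<longleftrightarrow> outer a (b v* Y) \<in> V" if "outer a b \<in> V" "Y \<in> G" for Y a b
  proof -
    have eq: "outer (Y *v a) b = commutator Y (outer a b) + outer a (b v* Y)"
      "outer a (b v* Y) = outer (Y *v a) b - commutator Y (outer a b)"
      by (simp_all add: commutator_outer)
    show ?thesis
      using inv(3)[OF that(2,1)] eq subspace_add[OF V(1)] subspace_diff[OF V(1)] by metis
  qed
  from dims show False
  proof
    assume d: "dim K = 3 \<and> dim E = 2"
    define K' where "K' = {a \<in> K. \<forall>b\<in>E. outer a b \<in> V}"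
    have K': "subspace K'"
      using K V(1) by (auto simp: K'_def subspace_def outer_linear)
    have TK: "T *v b \<in> K" for b
    proof -
      have "tensor K E \<subseteq> {A. A *v b \<in> K}"
        by (rule tensor_subset) (use K in \<open>auto simp: subspace_def outer_mult_vec matrix_vector_mult_add_rdistrib scaleR_matrix_vector_assoc[symmetric]\<close>)
      then show ?thesis using T(1) by blast
    qed
    \<comment> \<open>\<open>T\<close> maps the 2-dimensional \<open>E\<close> into the
      3-dimensional \<open>K\<close>, so some nonzero vector of \<open>K\<close> is orthogonal to
      the image; it lies in the radical.\<close>
    have "dim ((*v) T ` E) \<le> dim E" by (rule dim_image_le) simp
    then have "(*v) T ` E \<subseteq> K" "dim ((*v) T ` E) < dim K" using TK d by auto
    then obtain a where a: "a \<in> K" "a \<noteq> 0" "\<And>y. y \<in> (*v) T ` E \<Longrightarrow> inner a y = 0"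
      using exists_orthogonal_in_subspace[OF K] by blast
    have aK': "a \<in> K'" using a by (auto simp: K'_def outer_iff)
    have "E \<noteq> {0}" using d by auto
    then obtain b where b: "b \<in> E" "b \<noteq> 0" using subspace_0[OF E] by blast
    have "V = tensor K' E"
      by (rule Vtensor[OF _ _ _ aK' a(2) b]) (auto simp: K'_def inv comm)
    then have "5 = dim K' * 2" using dim_tensor[OF K' E] V(3) d by simp
    then show False by presburger
  next
    assume d: "dim K = 2 \<and> dim E = 3"
    \<comment> \<open>The mirror image of the previous case: the radical is now taken in
      \<open>E\<close>, and rows take the place of columns.\<close>
    define E' where "E' = {b \<in> E. \<forall>a\<in>K. outer a b \<in> V}"
    have E': "subspace E'"
      using E V(1) by (auto simp: E'_def subspace_def outer_linear)
    have TE: "a v* T \<in> E" for a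
    proof -
      have "tensor K E \<subseteq> {A. a v* A \<in> E}"
      proof (rule tensor_subset)
        have "linear (\<lambda>A. a v* A)"
          by (intro linearI) (simp_all add: vector_matrix_mult_def Finite_Cartesian_Product.vec_eq_iff
              algebra_simps sum.distrib sum_distrib_left)
        then show "subspace {A. a v* A \<in> E}"
          using linear_subspace_vimage[OF _ E] by (simp add: vimage_def)
      next
        fix c b assume "b \<in> E"
        moreover have "a v* outer c b = inner a c *\<^sub>R b"
          by (simp add: vector_matrix_mult_def outer_def Finite_Cartesian_Product.vec_eq_iff
              inner_vec_def sum_distrib_left mult_ac)
        ultimately show "outer c b \<in> {A. a v* A \<in> E}" using E by (simp add: subspace_scale)
      qed
      then show ?thesis using T(1) by blast
    qed
    have "dim ((\<lambda>a. a v* T) ` K) \<le> dim K"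
      by (rule dim_image_le) (auto intro!: linearI simp: vector_matrix_mult_def
          Finite_Cartesian_Product.vec_eq_iff algebra_simps sum.distrib sum_distrib_left)
    then have "(\<lambda>a. a v* T) ` K \<subseteq> E" "dim ((\<lambda>a. a v* T) ` K) < dim E" using TE d by auto
    then obtain b where b: "b \<in> E" "b \<noteq> 0" "\<And>y. y \<in> (\<lambda>a. a v* T) ` K \<Longrightarrow> inner b y = 0"
      using exists_orthogonal_in_subspace[OF E] by blast
    have "inner a (T *v b) = 0" if "a \<in> K" for a
      using b(3) that by (metis dot_lmul_matrix imageI inner_commute)
    then have bE': "b \<in> E'" using b by (auto simp: E'_def outer_iff)
    have "K \<noteq> {0}" using d by auto
    then obtain a where a: "a \<in> K" "a \<noteq> 0" using subspace_0[OF K] by blast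
    have "V = tensor K E'"
      by (rule Vtensor[OF _ _ _ a bE' b(2)]) (auto simp: E'_def inv comm[symmetric])
    then have "5 = 2 * dim E'" using dim_tensor[OF K E'] V(3) d by simp
    then show False by presburger
  qed
qed

section \<open>Jacobson's lemma on nilpotent commutators\<close>

text \<open>The derivation rule \<open>[S, a^(n+1)] = (n+1) a^n [S, a]\<close>, valid because
  \<open>M = [S, a]\<close> commutes with \<open>a\<close>. It serves for powers of \<open>a\<close>
  and, with \<open>M\<close> in place of \<open>a\<close>, for powers of \<open>M\<close>.\<close>

lemma commutator_funpow:
  fixes S a M :: "'v::real_vector \<Rightarrow> 'v"
  assumes "linear a" and M: "\<And>w. M w = S (a w) - a (S w)" and comm: "\<And>w. M (a w) = a (M w)"
  shows "S ((a ^^ Suc n) w) = (a ^^ Suc n) (S w) + real (Suc n) *\<^sub>R (a ^^ n) (M w)"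
proof (induction n)
  case 0
  then show ?case by (simp add: M)
next
  case (Suc n)
  have c: "M ((a ^^ k) w) = (a ^^ k) (M w)" for k by (induction k) (simp_all add: comm)
  have "S ((a ^^ Suc (Suc n)) w) = a (S ((a ^^ Suc n) w)) + M ((a ^^ Suc n) w)"
    by (simp add: M)
  also have "\<dots> = (a ^^ Suc (Suc n)) (S w) + real (Suc n) *\<^sub>R (a ^^ Suc n) (M w)
      + (a ^^ Suc n) (M w)"
    unfolding Suc c by (simp add: linear_add[OF assms(1)] linear_cmul[OF assms(1)])
  finally show ?case unfolding of_nat_Suc[of "Suc n"] scaleR_add_left scaleR_one by (simp only: add_ac)
qed

lemma linear_funpow:
  fixes f :: "'v::real_vector \<Rightarrow> 'v"
  assumes "linear f"
  shows "linear (f ^^ n)"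
proof (induction n)
  case 0
  show ?case by (simp add: linear_id[unfolded id_def] eq_id_iff[symmetric] linear_id)
next
  case (Suc n)
  then show ?case using linear_compose[OF Suc assms] by (simp add: o_def)
qed

text \<open>The powers of \<open>a\<close> lie in a finite-dimensional space of matrices, so they
  satisfy a polynomial relation. The condition on \<open>c d\<close> makes the degree exactly
  \<open>d\<close>, ready for induction on the degree.\<close>

lemma powers_dependent:
  fixes a :: "real^'n \<Rightarrow> real^'n"
  assumes "linear a"
  obtains c d where "c d \<noteq> 0" "\<And>w. (\<Sum>i\<le>d. c i *\<^sub>R (a ^^ i) w) = 0"
proof -
  define m where "m i = matrix (a ^^ i)" for i
  have m: "m i *v w = (a ^^ i) w" for i w
    by (simp add: m_def matrix_works linear_funpow[OF assms])
  have "\<exists>I c. finite I \<and> (\<exists>i\<in>I. c i \<noteq> 0) \<and> (\<Sum>i\<in>I. c i *\<^sub>R m i) = 0"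
  \<comment> \<open>Dependence is a property of sets, so repeated powers are treated apart; two
    equal powers give a relation at once.\<close>
  proof (cases "inj m")
    case True
    let ?D = "DIM(real^'n^'n)"
    have "card (m ` {..?D}) = Suc ?D"
      using True by (simp add: card_image inj_on_subset)
    then have "dependent (m ` {..?D})"
      by (intro dependent_biggerset) auto
    then obtain u where u: "\<exists>v\<in>m ` {..?D}. u v \<noteq> 0" "(\<Sum>v\<in>m ` {..?D}. u v *\<^sub>R v) = 0"
      by (auto simp: dependent_finite)
    then have "(\<Sum>i\<le>?D. u (m i) *\<^sub>R m i) = 0"
      using True by (simp add: sum.reindex inj_on_subset[OF True])
    then show ?thesis using u(1)
      by (intro exI[of _ "{..?D}"] exI[of _ "\<lambda>i. u (m i)"]) auto
  next
    case False
    then obtain i j where ij: "m i = m j" "i \<noteq> j" by (auto simp: inj_def)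
    then show ?thesis
      by (intro exI[of _ "{i, j}"] exI[of _ "\<lambda>k. if k = i then 1 else - 1"]) auto
  qed
  then obtain I c where I: "finite I" "\<exists>i\<in>I. c i \<noteq> 0" "(\<Sum>i\<in>I. c i *\<^sub>R m i) = 0" by blast
  define J where "J = {i\<in>I. c i \<noteq> 0}"
  define d where "d = Max J"
  have J: "finite J" "J \<noteq> {}" using I by (auto simp: J_def)
  then have dJ: "d \<in> J" and le: "\<And>i. i \<in> J \<Longrightarrow> i \<le> d" by (auto simp: d_def)
  define c' where "c' i = (if i \<in> J then c i else 0)" for i
  have "(\<Sum>i\<le>d. c' i *\<^sub>R (a ^^ i) w) = 0" for w
  proof -
    have "(\<Sum>i\<le>d. c' i *\<^sub>R (a ^^ i) w) = (\<Sum>i\<in>J. c i *\<^sub>R (a ^^ i) w)"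
      by (rule sum.mono_neutral_cong_right) (use le in \<open>auto simp: c'_def\<close>)
    also have "\<dots> = (\<Sum>i\<in>I. c i *\<^sub>R (a ^^ i) w)"
      by (rule sum.mono_neutral_left) (use I in \<open>auto simp: J_def\<close>)
    also have "\<dots> = (\<Sum>i\<in>I. c i *\<^sub>R m i) *v w"
      by (simp add: m[symmetric] scaleR_matrix_vector_assoc
          linear_sum[of "\<lambda>A. A *v w"] linearI matrix_vector_mult_add_rdistrib)
    finally show ?thesis using I by simp
  qed
  moreover have "c' d \<noteq> 0" using dJ by (simp add: c'_def J_def)
  ultimately show thesis using that by blast
qed

text \<open>
  Jacobson's lemma. If \<open>P(a) M\<^sup>n = 0\<close> for a polynomial \<open>P\<close>, then commuting with \<open>S\<close> gives
  \<open>P'(a) M\<^bsup>n+2\<^esup> = 0\<close>; repeat until \<open>P\<close> is a nonzero constant.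
\<close>
lemma commutator_nilpotent:
  fixes S a M :: "real^'n \<Rightarrow> real^'n"
  assumes lin: "linear S" "linear a" and M: "\<And>w. M w = S (a w) - a (S w)"
    and comm: "\<And>w. M (a w) = a (M w)"
    and M': "\<And>w. M' w = S (M w) - M (S w)" and comm': "\<And>w. M' (M w) = M (M' w)"
  shows "\<exists>n. \<forall>w. (M ^^ n) w = 0"
proof -
  have linM: "linear M"
    unfolding M using linear_compose_sub[OF linear_compose[OF lin(2,1)] linear_compose[OF lin]]
    by (simp add: o_def)
  have la: "linear (a ^^ i)" for i by (rule linear_funpow[OF lin(2)])
  \<comment> \<open>Induction on the exact degree \<open>d\<close> of \<open>P\<close>. In degree 0
    the relation is a nonzero multiple of \<open>M^n\<close>; differentiation keeps the leading
    coefficient nonzero.\<close>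
  have "\<exists>n. \<forall>w. (M ^^ n) w = 0"
    if "c d \<noteq> 0" "\<And>w. (\<Sum>i\<le>d. c i *\<^sub>R (a ^^ i) ((M ^^ n) w)) = 0" for c d n
    using that
  proof (induction d arbitrary: c n)
    case 0
    then show ?case by auto
  next
    case (Suc d)
    define P where "P u = (\<Sum>i\<le>Suc d. c i *\<^sub>R (a ^^ i) u)" for u
    define P' where "P' u = (\<Sum>i\<le>d. (real (Suc i) * c (Suc i)) *\<^sub>R (a ^^ i) u)" for u
    have linP: "linear P"
      unfolding P_def by (intro linear_compose_sum ballI linear_compose_scale_right la)
    have PM: "P ((M ^^ n) u) = 0" for u using Suc.prems(2) by (simp add: P_def)
    \<comment> \<open>This is \<open>[S, P(a)] = P'(a) M\<close>, obtained term by term from the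
      derivation rule.\<close>
    have key: "S (P u) = P (S u) + P' (M u)" for u
    proof -
      have "S (P u) = c 0 *\<^sub>R S u + (\<Sum>i\<le>d. c (Suc i) *\<^sub>R S ((a ^^ Suc i) u))"
        unfolding P_def sum.atMost_Suc_shift
        by (simp add: linear_add[OF lin(1)] linear_sum[OF lin(1)] linear_cmul[OF lin(1)])
      also have "\<dots> = P (S u) + P' (M u)"
        unfolding commutator_funpow[of a M S, OF lin(2) M comm] P_def P'_def sum.atMost_Suc_shift
        by (simp add: scaleR_add_right sum.distrib mult_ac del: funpow.simps)
      finally show ?thesis .
    qed
    \<comment> \<open>Apply \<open>key\<close> to \<open>M^(n+1) w\<close>. The left side vanishes
      since \<open>P(a) M^n = 0\<close>. So does \<open>P(a) S M^(n+1) w\<close>, because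
      \<open>S M^(n+1) = M^(n+1) S + (n+1) M^n M'\<close> and every term on the right begins with
      \<open>M^n\<close>.\<close>
    have "P' ((M ^^ (n + 2)) w) = 0" for w
    proof -
      have "P (S ((M ^^ Suc n) w)) = 0"
        unfolding commutator_funpow[of M M' S, OF linM M' comm'] linear_add[OF linP] linear_cmul[OF linP]
        by (simp add: PM funpow_swap1)
      moreover have "P ((M ^^ Suc n) w) = 0"
        using PM[of "M w"] by (simp add: funpow_swap1)
      ultimately show ?thesis
        using key[of "(M ^^ Suc n) w"] linear_0[OF lin(1)] by simp
    qed
    then show ?case
      using Suc.prems(1) by (intro Suc.IH[of "\<lambda>i. real (Suc i) * c (Suc i)" "n + 2"])
        (simp_all add: P'_def)
  qed
  note * = this
  obtain c d where "c d \<noteq> 0" "\<And>w. (\<Sum>i\<le>d. c i *\<^sub>R (a ^^ i) w) = 0"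
    using powers_dependent[OF lin(2)] by blast
  then show ?thesis by (intro *[of c d 0]) simp_all
qed

section \<open>A common null vector for commuting nilpotent maps\<close>

text \<open>Engel's theorem in the commuting case, stated for the quotient by \<open>K\<close>
  without forming it: being outside \<open>K\<close> means being nonzero, being mapped into
  \<open>K\<close> means being killed.\<close>

lemma exists_common_nilpotent_vector:
  fixes F :: "('v::zero \<Rightarrow> 'v) set"
  assumes "finite F" "\<And>f w. f \<in> F \<Longrightarrow> \<exists>n. (f ^^ n) w = 0"
    and comm: "\<And>f h w. f \<in> F \<Longrightarrow> h \<in> F \<Longrightarrow> f (h w) = h (f w)"
    and K: "K \<noteq> UNIV" "0 \<in> K" and inv: "\<And>f w. f \<in> F \<Longrightarrow> w \<in> K \<Longrightarrow> f w \<in> K"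
  shows "\<exists>w. w \<notin> K \<and> (\<forall>f\<in>F. f w \<in> K)"
  using assms(1-3) inv
proof (induction F rule: finite_induct)
  case empty
  then show ?case using K by auto
next
  case (insert f F)
  have "\<exists>w. w \<notin> K \<and> (\<forall>h\<in>F. h w \<in> K)"
    using insert.prems by (intro insert.IH) auto
  then obtain w where w: "w \<notin> K" "\<And>h. h \<in> F \<Longrightarrow> h w \<in> K" by blast
  obtain n where "(f ^^ n) w = 0" using insert.prems(1)[of f w] by auto
  then have "\<exists>n. (f ^^ n) w \<in> K" using K by metis
  \<comment> \<open>The last iterate of \<open>f\<close> on \<open>w\<close> outside
    \<open>K\<close> is sent into \<open>K\<close> by \<open>f\<close>, and still by every
    \<open>h\<close> in \<open>F\<close>, since \<open>h\<close> commutes with the powers of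
    \<open>f\<close>, which preserve \<open>K\<close>.\<close>
  then obtain n where n: "(f ^^ n) w \<in> K" "\<And>m. m < n \<Longrightarrow> (f ^^ m) w \<notin> K"
    using exists_least_iff[of "\<lambda>n. (f ^^ n) w \<in> K"] by blast
  with w obtain m where m: "n = Suc m" by (cases n) auto
  have c: "h ((f ^^ k) w) = (f ^^ k) (h w)" if "h \<in> F" for h k
    by (induction k) (use insert.prems(2)[of h f] that in auto)
  have i: "(f ^^ k) u \<in> K" if "u \<in> K" for u k
    by (induction k) (use that insert.prems(3)[of f] in auto)
  have "\<forall>h\<in>F. h ((f ^^ m) w) \<in> K"
    using c i[OF w(2)] by metis
  then show ?case using n[unfolded m] by (intro exI[of _ "(f ^^ m) w"]) auto
qed

section \<open>No faithful representation in dimension 5\<close>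

text \<open>\<open>R\<close> and \<open>S\<close> stand for the restrictions of a faithful
  representation to the abelian ideal and to \<open>g\<close>; \<open>comm\<close> and
  \<open>act\<close> are the bracket relations among them that lead to the contradiction.\<close>

lemma no_rep_on_real_5:
  fixes \<phi> :: "'a \<Rightarrow> real^5 \<Rightarrow> real^5" and S :: "'a \<Rightarrow> real^5^5" and R :: "real^5 \<Rightarrow> real^5^5"
  assumes lin: "\<And>x. x \<in> g \<Longrightarrow> linear (\<phi> x)"
    and irr: "\<And>U. subspace U \<Longrightarrow> (\<And>x u. x \<in> g \<Longrightarrow> u \<in> U \<Longrightarrow> \<phi> x u \<in> U) \<Longrightarrow> U = {0} \<or> U = UNIV"
    and nontriv: "\<exists>x\<in>g. \<exists>v. \<phi> x v \<noteq> 0"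
    and R: "linear R" "inj R" and comm: "\<And>v w. R v ** R w = R w ** R v"
    and act: "\<And>x v. x \<in> g \<Longrightarrow> R (\<phi> x v) = commutator (S x) (R v)"
  shows False
proof -
  have linmv: "linear (\<lambda>v. R v *v w)" for w
    by (intro linearI) (simp_all add: linear_add[OF R(1)] linear_cmul[OF R(1)]
        matrix_vector_mult_add_rdistrib scaleR_matrix_vector_assoc)
  have acts: "R v *v (S x *v w) = S x *v (R v *v w) - R (\<phi> x v) *v w" if "x \<in> g" for x v w
    by (simp add: act[OF that] commutator_def matrix_vector_mul_assoc matrix_vector_mult_diff_rdistrib)
  have comms: "R v *v (R u *v w) = R u *v (R v *v w)" for u v w
    by (simp add: matrix_vector_mul_assoc comm)
  define D where "D = {\<phi> x v |x v. x \<in> g}"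
  have "span D = UNIV"
  proof -
    have "span D = {0} \<or> span D = UNIV"
      by (rule irr) (auto simp: D_def intro: span_base)
    moreover have "span D \<noteq> {0}"
    proof -
      obtain x v where "x \<in> g" "\<phi> x v \<noteq> 0" using nontriv by blast
      then have "\<phi> x v \<in> span D" by (auto simp: D_def intro: span_base)
      then show ?thesis using \<open>\<phi> x v \<noteq> 0\<close> by auto
    qed
    ultimately show ?thesis by blast
  qed
  \<comment> \<open>A finite spanning set is chosen among the vectors \<open>\<phi> x v\<close>,
    because these are the ones known to act nilpotently and the null vector lemma takes finitely
    many maps.\<close>
  moreover obtain F where F: "F \<subseteq> D" "independent F" "D \<subseteq> span F"
    using maximal_independent_subset[of D] by blast
  ultimately have spanF: "span F = UNIV"
    using span_minimal[OF F(3) subspace_span] by auto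
  have finF: "finite F" using F(2) by (rule independent_imp_finite)
  \<comment> \<open>Here \<open>R u\<close> is the commutator of \<open>S x\<close> with
    \<open>R v\<close>. It commutes with \<open>R v\<close>, and its own commutator with
    \<open>S x\<close> is \<open>R (\<phi> x u)\<close>, which commutes with it.\<close>
  have nilpotent: "\<exists>n. \<forall>w. (((*v) (R u)) ^^ n) w = 0" if u: "u \<in> D" for u
  proof -
    obtain x v where x: "x \<in> g" "u = \<phi> x v" using u by (auto simp: D_def)
    show ?thesis
      by (rule commutator_nilpotent[where S = "(*v) (S x)" and a = "(*v) (R v)"
            and M' = "(*v) (R (\<phi> x u))"])
        (simp_all add: acts x comms)
  qed
  have engel: "\<exists>w. w \<notin> K \<and> (\<forall>v. R v *v w \<in> K)"
    if K: "subspace K" "K \<noteq> UNIV" and inv: "\<And>v w. w \<in> K \<Longrightarrow> R v *v w \<in> K" for K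
  proof -
    have "\<exists>w. w \<notin> K \<and> (\<forall>f\<in>(\<lambda>v. (*v) (R v)) ` F. f w \<in> K)"
      by (rule exists_common_nilpotent_vector)
        (use finF F(1) nilpotent comms K inv subspace_0 in blast)+
    then obtain w where w: "w \<notin> K" "\<And>v. v \<in> F \<Longrightarrow> R v *v w \<in> K" by auto
    have "F \<subseteq> {v. R v *v w \<in> K}" using w by auto
    moreover have "subspace {v. R v *v w \<in> K}"
      using linear_subspace_vimage[OF linmv K(1)] by (simp add: vimage_def)
    ultimately have "span F \<subseteq> {v. R v *v w \<in> K}" by (rule span_minimal)
    then show ?thesis using w spanF by auto
  qed
  define K where "K = {w. \<forall>v. R v *v w = 0}"
  define K2 where "K2 = {w. \<forall>v. R v *v w \<in> K}"
  have K: "subspace K"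
    by (auto simp: K_def subspace_def matrix_vector_right_distrib matrix_vector_mult_scaleR)
  have K2: "subspace K2"
    using K by (auto simp: K2_def subspace_def matrix_vector_right_distrib matrix_vector_mult_scaleR)
  have SK: "S x *v w \<in> K" if "x \<in> g" "w \<in> K" for x w
    using that by (simp add: K_def acts)
  have SK2: "S x *v w \<in> K2" if "x \<in> g" "w \<in> K2" for x w
    using that SK by (auto simp: K2_def acts intro: subspace_diff[OF K])
  have KK2: "K \<subseteq> K2" using subspace_0[OF K] by (auto simp: K_def K2_def)
  have RK: "R v *v w = 0" if "w \<in> K" for v w using that by (simp add: K_def)
  have "K \<noteq> UNIV"
  proof
    assume "K = UNIV"
    then have "R v = R 0" for v
      unfolding matrix_eq using RK by auto
    then show False using R(2) by (metis UNIV_I injD vec5_nth(1) zero_index zero_neq_one)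
  qed
  then obtain w0 where w0: "w0 \<notin> K" "w0 \<in> K2"
    using engel[OF K] RK subspace_0[OF K] by (auto simp: K2_def)
  \<comment> \<open>The orthogonal complement of \<open>K\<close> in \<open>K2\<close> represents
    the quotient of \<open>K2\<close> by \<open>K\<close>.\<close>
  define E where "E = {e \<in> K2. \<forall>k\<in>K. Linear_Algebra.orthogonal k e}"
  have E: "subspace E"
    using K2 by (auto simp: E_def subspace_def Linear_Algebra.orthogonal_def inner_add_right)
  have dimE: "dim E + dim K = dim K2"
    unfolding E_def by (rule dim_subspace_orthogonal_to_vectors[OF K K2 KK2])
  obtain B where B: "B \<subseteq> E" "pairwise Linear_Algebra.orthogonal B" "\<And>x. x \<in> B \<Longrightarrow> norm x = 1"
    "independent B" "card B = dim E" "span B = E"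
    using orthonormal_basis_subspace[OF E] by blast
  have finB: "finite B" using B(4) by (rule independent_imp_finite)
  \<comment> \<open>\<open>T v\<close> is \<open>R v\<close> preceded by the orthogonal projection
    onto \<open>E\<close>. It agrees with \<open>R v\<close> on \<open>K2\<close> and lies in
    \<open>tensor K E\<close>.\<close>
  define T where "T v = (\<Sum>b\<in>B. outer (R v *v b) b)" for v
  have linT: "linear T"
    by (intro linearI) (simp_all add: T_def linear_add[OF linmv] linear_cmul[OF linmv]
        outer_linear sum.distrib scaleR_sum_right)
  have Tapp: "T v *v w = (\<Sum>b\<in>B. inner b w *\<^sub>R (R v *v b))" for v w
  proof -
    have "linear (\<lambda>A :: real^5^5. A *v w)"
      by (intro linearI) (simp_all add: matrix_vector_mult_add_rdistrib scaleR_matrix_vector_assoc)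
    from linear_sum[OF this, of "\<lambda>b. outer (R v *v b) b" B] show ?thesis
      by (simp add: T_def outer_mult_vec)
  qed
  have TE: "T v *v e = R v *v e" if "e \<in> E" for v e
  proof -
    have *: "T v *v b = R v *v b" if b: "b \<in> B" for b
    proof -
      have "T v *v b = (\<Sum>b'\<in>B. if b' = b then R v *v b else 0)"
        unfolding Tapp using B(2,3) b
        by (intro sum.cong) (auto simp: pairwise_def Linear_Algebra.orthogonal_def dot_square_norm)
      then show ?thesis using finB b by simp
    qed
    have "e \<in> span B" using that B(6) by simp
    then show ?thesis
      by (induction rule: span_induct_alt)
        (simp_all add: * matrix_vector_right_distrib matrix_vector_mult_scaleR)
  qed
  have TK: "T v *v k = 0" if "k \<in> K" for v k
    unfolding Tapp using B(1) that
    by (intro sum.neutral) (auto simp: E_def Linear_Algebra.orthogonal_def inner_commute)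
  have TR: "T v *v w = R v *v w" if w: "w \<in> K2" for v w
  proof -
    obtain y z where yz: "y \<in> span K" "\<And>u. u \<in> span K \<Longrightarrow> Linear_Algebra.orthogonal z u" "w = y + z"
      using orthogonal_subspace_decomp_exists[of K w] by blast
    then have y: "y \<in> K" using K by (simp add: span_eq_iff[THEN iffD2])
    have "z = w - y" using yz by simp
    then have "z \<in> K2" using w y KK2 K2 by (auto intro: subspace_diff)
    then have "z \<in> E" using yz(2) by (auto simp: E_def span_base orthogonal_commute)
    then show ?thesis using y by (simp add: yz(3) matrix_vector_right_distrib TE TK RK)
  qed
  have Ttensor: "T v \<in> tensor K E" for v
    unfolding T_def using B(1) w0
    by (intro subspace_sum[OF subspace_tensor] outer_in_tensor) (auto simp: E_def K2_def)
  have "inj T"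
  proof -
    \<comment> \<open>The vectors acting as zero on \<open>K2\<close> form an invariant subspace,
      which is proper because \<open>w0\<close> is outside \<open>K\<close>.\<close>
    define U where "U = {v. \<forall>w\<in>K2. R v *v w = 0}"
    have "subspace U"
      by (auto simp: U_def subspace_def linear_add[OF linmv] linear_cmul[OF linmv] linear_0[OF linmv])
    moreover have "\<phi> x v \<in> U" if "x \<in> g" "v \<in> U" for x v
    proof -
      have "R (\<phi> x v) *v w = S x *v (R v *v w) - R v *v (S x *v w)" for w
        by (simp add: acts[OF that(1)])
      then show ?thesis using that(2) SK2[OF that(1)] by (simp add: U_def)
    qed
    moreover have "U \<noteq> UNIV" using w0 by (auto simp: U_def K_def)
    ultimately have "U = {0}" using irr by blast
    moreover have "v \<in> U" if "T v = 0" for v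
      using TR[of _ v] that by (auto simp: U_def)
    ultimately show ?thesis
      using linear_injective_0[OF linT] by blast
  qed
  then have dimT: "dim (range T) = 5"
    using dim_image_eq[OF linT, of UNIV] by simp
  have "dim (range T) \<le> dim (tensor K E)"
    by (rule dim_subset) (use Ttensor in auto)
  then have kq: "5 \<le> dim K * dim E" using dimT by (simp add: dim_tensor K E)
  have le5: "dim K2 \<le> 5" using dim_subset_UNIV[of K2] by simp
  have split: "dim K = 3 \<and> dim E = 2 \<or> dim K = 2 \<and> dim E = 3"
  proof -
    \<comment> \<open>If the sum is at most 5, the product reaches 5 only for 2 and 3: 1 and 4 give
      just 4.\<close>
    have *: "k = 3 \<and> q = 2 \<or> k = 2 \<and> q = 3" if "5 \<le> k * q" "q + k \<le> 5" for k q :: nat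
    proof -
      have "k = 0 \<or> k = 1 \<or> k = 2 \<or> k = 3 \<or> k = 4 \<or> k = 5" using that(2) by arith
      then show ?thesis using that by (elim disjE) auto
    qed
    show ?thesis by (rule *[OF kq]) (simp add: dimE le5)
  qed
  then have "dim K2 = DIM(real^5)" using dimE by auto
  then have K2U: "K2 = UNIV" using K2 dim_eq_full[of K2] by (simp add: span_eq_iff[THEN iffD2])
  have "T = R" using TR by (simp add: fun_eq_iff matrix_eq K2U)
  have E_iff: "e \<in> E \<longleftrightarrow> (\<forall>k\<in>K. inner e k = 0)" for e
    by (auto simp: E_def K2U Linear_Algebra.orthogonal_def inner_commute)
  show False
  proof (rule no_irreducible_hyperplane_in_tensor[OF K E, of "range R" "S ` g"])
    show "subspace (range R)" using R(1) by (rule linear_subspace_image) simp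
    show "range R \<subseteq> tensor K E" "dim (range R) = 5"
      using Ttensor dimT \<open>T = R\<close> by auto
    show "dim K = 3 \<and> dim E = 2 \<or> dim K = 2 \<and> dim E = 3" by (rule split)
    show "Y *v a \<in> K" if "Y \<in> S ` g" "a \<in> K" for Y a using that SK by auto
    \<comment> \<open>Right multiplication is the transposed action, so it preserves the orthogonal
      complement of the invariant subspace \<open>K\<close>.\<close>
    show "b v* Y \<in> E" if "Y \<in> S ` g" "b \<in> E" for Y b
      using that SK by (auto simp: E_iff dot_lmul_matrix)
    show "commutator Y A \<in> range R" if "Y \<in> S ` g" "A \<in> range R" for Y A
      using that by (auto simp: act[symmetric])
    show "M = {0} \<or> M = range R"
      if M: "subspace M" "M \<subseteq> range R" "\<And>Y A. Y \<in> S ` g \<Longrightarrow> A \<in> M \<Longrightarrow> commutator Y A \<in> M" for M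
    proof -
      have "R -` M = {0} \<or> R -` M = UNIV"
        by (rule irr) (auto simp: act M(3) linear_subspace_vimage[OF R(1) M(1)])
      moreover have "M = R ` (R -` M)" using M(2) by auto
      ultimately show ?thesis using linear_0[OF R(1)] by (metis image_empty image_insert)
    qed
  qed
qed

section \<open>Matrices of varying size inside a fixed matrix type\<close>

text \<open>Padding by zeros: \<open>h\<close> numbers the index type, and indices numbered
  \<open>N\<close> or higher give zero rows and columns. A faithful representation of any size up to
  5 thus becomes a faithful one by 5 x 5 matrices.\<close>

definition matrix_of_mat :: "('n::finite \<Rightarrow> nat) \<Rightarrow> nat \<Rightarrow> real Matrix.mat \<Rightarrow> real^'n^'n" where
  "matrix_of_mat h N A = (\<chi> i j. if h i < N \<and> h j < N then A $$ (h i, h j) else 0)"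

lemma matrix_of_mat_arith:
  assumes "A \<in> carrier_mat N N" "B \<in> carrier_mat N N"
  shows "matrix_of_mat h N (A + B) = matrix_of_mat h N A + matrix_of_mat h N B"
    "matrix_of_mat h N (A - B) = matrix_of_mat h N A - matrix_of_mat h N B"
    "matrix_of_mat h N (c \<cdot>\<^sub>m A) = c *\<^sub>R matrix_of_mat h N A"
  using assms by (simp_all add: matrix_of_mat_def Finite_Cartesian_Product.vec_eq_iff)

lemma matrix_of_mat_mult:
  fixes h :: "'n::finite \<Rightarrow> nat"
  assumes h: "bij_betw h UNIV {0..<CARD('n)}" and N: "N \<le> CARD('n)"
    and A: "A \<in> carrier_mat N N" and B: "B \<in> carrier_mat N N"
  shows "matrix_of_mat h N (A * B) = matrix_of_mat h N A ** matrix_of_mat h N B"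
proof -
  have "(\<Sum>k<N. A $$ (h i, k) * B $$ (k, h j))
      = (\<Sum>k\<in>UNIV. matrix_of_mat h N A $ i $ k * matrix_of_mat h N B $ k $ j)"
    if "h i < N" "h j < N" for i j
  proof -
    let ?f = "\<lambda>k. if k < N then A $$ (h i, k) * B $$ (k, h j) else 0"
    have "(\<Sum>k<N. A $$ (h i, k) * B $$ (k, h j)) = (\<Sum>k\<in>{0..<CARD('n)}. ?f k)"
      by (rule sum.mono_neutral_cong_left) (use N in auto)
    also have "\<dots> = (\<Sum>k\<in>UNIV. ?f (h k))"
      by (rule sum.reindex_bij_betw[OF h, symmetric])
    finally show ?thesis using that by (simp add: matrix_of_mat_def if_distrib cong: if_cong)
  qed
  then show ?thesis
    using A B by (auto simp: matrix_of_mat_def Finite_Cartesian_Product.vec_eq_iff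
        matrix_matrix_mult_def scalar_prod_def atLeast0LessThan)
qed

lemma inj_on_matrix_of_mat:
  fixes h :: "'n::finite \<Rightarrow> nat"
  assumes h: "bij_betw h UNIV {0..<CARD('n)}" and N: "N \<le> CARD('n)"
  shows "inj_on (matrix_of_mat h N) (carrier_mat N N)"
proof (rule inj_onI)
  fix A B assume A: "A \<in> carrier_mat N N" and B: "B \<in> carrier_mat N N"
    and eq: "matrix_of_mat h N A = matrix_of_mat h N B"
  show "A = B"
  proof (rule eq_matI)
    fix i j assume "i < dim_row B" "j < dim_col B"
    then have ij: "i < N" "j < N" using B by auto
    then have "i \<in> h ` UNIV" "j \<in> h ` UNIV" using h N by (auto simp: bij_betw_def)
    then obtain i' j' where "i = h i'" "j = h j'" by blast
    moreover have "matrix_of_mat h N A $ i' $ j' = matrix_of_mat h N B $ i' $ j'" by (simp add: eq)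
    ultimately show "A $$ (i, j) = B $$ (i, j)" using ij by (simp add: matrix_of_mat_def)
  qed (use A B in auto)
qed

section \<open>The value of \<open>mu\<close> for a semidirect product\<close>

text \<open>Under the zero action every line is invariant, and a line is proper in dimension greater
  than 1.\<close>

lemma exists_nontrivial_action:
  fixes \<phi> :: "'a::real_vector \<Rightarrow> 'v::euclidean_space \<Rightarrow> 'v"
  assumes "irreducible_lie_rep g br \<phi>" "DIM('v) > 1"
  shows "\<exists>x\<in>g. \<exists>v. \<phi> x v \<noteq> 0"
proof (rule ccontr)
  assume "\<not> ?thesis"
  then have 0: "\<phi> x v = 0" if "x \<in> g" for x v using that by blast
  obtain b :: 'v where b: "b \<in> Basis" by (meson nonempty_Basis ex_in_conv)
  have "\<phi> x ` span {b} \<subseteq> span {b}" if "x \<in> g" for x using 0[OF that] by (auto simp: span_zero)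
  then have "span {b} = {0} \<or> span {b} = UNIV"
    using assms(1) by (auto simp: irreducible_lie_rep_def)
  moreover have "span {b} \<noteq> {0}" using b span_base[of b "{b}"] nonzero_Basis by auto
  moreover have "span {b} \<noteq> UNIV"
  proof
    assume "span {b} = UNIV"
    then have "dim {b} = DIM('v)" by (metis dim_UNIV dim_span)
    then show False using assms(2) dim_le_card'[of "{b}"] by simp
  qed
  ultimately show False by blast
qed

text \<open>Simplicity of \<open>g\<close> makes the affine representation in dimension 6 faithful;
  the lower bound is \<open>no_rep_on_real_5\<close> applied after padding.\<close>

lemma mu_semidirect_eq_6:
  fixes g :: "'a::real_vector set" and \<phi> :: "'a \<Rightarrow> real^5 \<Rightarrow> real^5"
  assumes lie: "lie_algebra g br"
    and simple: "\<And>I. subspace I \<Longrightarrow> I \<subseteq> g \<Longrightarrow> (\<And>x y. x \<in> g \<Longrightarrow> y \<in> I \<Longrightarrow> br x y \<in> I)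
      \<Longrightarrow> I = {0} \<or> I = g"
    and irred: "irreducible_lie_rep g br \<phi>"
  shows "mu (g \<times> UNIV) (semidirect_bracket br \<phi>) = 6"
proof -
  have g: "subspace g" and br: "\<And>x y. x \<in> g \<Longrightarrow> y \<in> g \<Longrightarrow> br x y \<in> g"
    using lie by (auto simp: lie_algebra_def)
  have lin: "linear (\<phi> x)" if "x \<in> g" for x
    using irred that by (auto simp: irreducible_lie_rep_def lie_rep_def)
  have \<phi>: "\<phi> (x + y) v = \<phi> x v + \<phi> y v" "\<phi> (c *\<^sub>R x) v = c *\<^sub>R \<phi> x v"
    "\<phi> (br x y) v = \<phi> x (\<phi> y v) - \<phi> y (\<phi> x v)" if "x \<in> g" "y \<in> g" for x y c v
    using irred that by (auto simp: irreducible_lie_rep_def lie_rep_def)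
  have g0: "0 \<in> g" using g by (rule subspace_0)
  have \<phi>0: "\<phi> 0 v = 0" for v using \<phi>(2)[OF g0 g0, of 0] by simp
  have br0: "br x 0 = 0" "br 0 x = 0" if "x \<in> g" for x
  proof -
    have "br (0 *\<^sub>R 0) x = 0 *\<^sub>R br 0 x" "br x (0 *\<^sub>R 0) = 0 *\<^sub>R br x 0"
      using lie g0 that unfolding lie_algebra_def by blast+
    then show "br x 0 = 0" "br 0 x = 0" by simp_all
  qed
  have nontriv: "\<exists>x\<in>g. \<exists>v. \<phi> x v \<noteq> 0"
    by (rule exists_nontrivial_action[OF irred]) simp
  have faithful: "x = y" if xy: "x \<in> g" "y \<in> g" "\<phi> x = \<phi> y" for x y
  proof -
    \<comment> \<open>The kernel of the action is an ideal, and it is not \<open>g\<close> because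
      the action is nontrivial.\<close>
    let ?I = "{z \<in> g. \<forall>v. \<phi> z v = 0}"
    have "?I = {0} \<or> ?I = g"
    proof (rule simple)
      show "subspace ?I"
        using g \<phi>(1,2) by (auto simp: subspace_def \<phi>0)
      show "br z w \<in> ?I" if "z \<in> g" "w \<in> ?I" for z w
        using that br \<phi>(3) linear_0[OF lin[OF that(1)]] by auto
    qed auto
    moreover have "?I \<noteq> g" using nontriv by blast
    moreover have "x + (- 1) *\<^sub>R y \<in> ?I"
    proof -
      have "(- 1) *\<^sub>R y \<in> g" using g xy(2) by (rule subspace_scale)
      moreover from this have "\<phi> (x + (- 1) *\<^sub>R y) v = \<phi> x v + (- 1) *\<^sub>R \<phi> y v" for v
        using \<phi>(1)[OF xy(1)] \<phi>(2)[OF xy(2,2)] by metis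
      ultimately show ?thesis using subspace_add[OF g xy(1)] xy(3) by force
    qed
    ultimately have "x + (- 1) *\<^sub>R y = 0" by blast
    then show ?thesis by simp
  qed
  obtain h :: "5 \<Rightarrow> nat" where h: "bij_betw h UNIV {0..<CARD(5)}"
    using ex_bij_betw_finite_nat[of "UNIV :: 5 set"] by auto
  show ?thesis
    unfolding mu_def
  proof (rule Least_equality)
    define e where "e = inv_into UNIV h"
    have eh: "e (h i) = i" for i
      using h by (simp add: e_def bij_betw_def)
    have sum_e: "(\<Sum>k\<in>{0..<5}. f (e k)) = (\<Sum>k\<in>UNIV. f k)" for f :: "5 \<Rightarrow> real"
      using sum.reindex_bij_betw[OF h, of "\<lambda>k. f (e k)"] by (simp add: eh)
    have he: "i < 5 \<Longrightarrow> h (e i) = i" for i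
      using h by (simp add: e_def bij_betw_def f_inv_into_f)
    define M where "M x = matrix (\<phi> x)" for x
    have M: "M x *v v = \<phi> x v" if "x \<in> g" for x v
      by (simp add: M_def matrix_works lin[OF that])
    have Madd: "M (x + y) = M x + M y" "M (c *\<^sub>R x) = c *\<^sub>R M x"
      "M (br x y) = M x ** M y - M y ** M x" if "x \<in> g" "y \<in> g" for x y c
      using that g br unfolding matrix_eq
      by (simp_all add: M \<phi> subspace_add subspace_scale matrix_vector_mult_add_rdistrib
          scaleR_matrix_vector_assoc[symmetric] matrix_vector_mult_diff_rdistrib
          matrix_vector_mul_assoc[symmetric])
    \<comment> \<open>The affine action in block form: the linear part fills the first five rows and
      columns, the translation is the last column (index 5), and the last row is zero.\<close>
    define \<rho> where "\<rho> p = Matrix.mat 6 6 (\<lambda>(i, j). if i < 5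
        then if j < 5 then M (fst p) $ e i $ e j else snd p $ e i else 0)" for p
    have mult: "(\<rho> p * \<rho> q) $$ (i, j) = (if i < 5
        then if j < 5 then (M (fst p) ** M (fst q)) $ e i $ e j else (M (fst p) *v snd q) $ e i
        else 0)" if "i < 6" "j < 6" for p q i j
    proof -
      have "(\<rho> p * \<rho> q) $$ (i, j) = (\<Sum>k\<in>{0..<6}. \<rho> p $$ (i, k) * \<rho> q $$ (k, j))"
        using that by (simp add: scalar_prod_def \<rho>_def)
      also have "\<dots> = (\<Sum>k\<in>{0..<5}. \<rho> p $$ (i, k) * \<rho> q $$ (k, j)) + \<rho> p $$ (i, 5) * \<rho> q $$ (5, j)"
        using sum.atLeast0_lessThan_Suc[of "\<lambda>k. \<rho> p $$ (i, k) * \<rho> q $$ (k, j)" 5] by simp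
      also have "\<rho> q $$ (5, j) = 0" using that by (simp add: \<rho>_def)
      also have "(\<Sum>k\<in>{0..<5}. \<rho> p $$ (i, k) * \<rho> q $$ (k, j))
          = (\<Sum>k\<in>{0..<5}. if i < 5 then M (fst p) $ e i $ e k *
              (if j < 5 then M (fst q) $ e k $ e j else snd q $ e k) else 0)"
        by (rule sum.cong) (use that in \<open>auto simp: \<rho>_def\<close>)
      finally show ?thesis
        using sum_e[of "\<lambda>k. M (fst p) $ e i $ k * M (fst q) $ k $ e j"]
          sum_e[of "\<lambda>k. M (fst p) $ e i $ k * snd q $ k"]
        by (simp add: matrix_matrix_mult_def matrix_vector_mult_def)
    qed
    have "inj_on \<rho> (g \<times> UNIV)"
    proof (rule inj_onI)
      fix p q assume p: "p \<in> g \<times> UNIV" and q: "q \<in> g \<times> UNIV" and eq: "\<rho> p = \<rho> q"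
      have h5: "h i < 5" for i using h by (auto simp: bij_betw_def)
      have "\<rho> p $$ (h i, h j) = \<rho> q $$ (h i, h j)" "\<rho> p $$ (h i, 5) = \<rho> q $$ (h i, 5)" for i j
        by (simp_all add: eq)
      moreover have "h i < 6" for i using h5[of i] by simp
      ultimately have "M (fst p) = M (fst q)" "snd p = snd q"
        by (simp_all add: \<rho>_def eh h5 Finite_Cartesian_Product.vec_eq_iff)
      moreover from this have "fst p = fst q"
        using p q by (intro faithful) (auto simp: M[symmetric] fun_eq_iff)
      ultimately show "p = q" by (simp add: prod_eq_iff)
    qed
    moreover have "\<rho> (semidirect_bracket br \<phi> p q) = \<rho> p * \<rho> q - \<rho> q * \<rho> p"
      if "p \<in> g \<times> UNIV" "q \<in> g \<times> UNIV" for p q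
    proof (rule eq_matI)
      fix i j assume "i < dim_row (\<rho> p * \<rho> q - \<rho> q * \<rho> p)" "j < dim_col (\<rho> p * \<rho> q - \<rho> q * \<rho> p)"
      then have ij: "i < 6" "j < 6" by (simp_all add: \<rho>_def)
      have "fst p \<in> g" "fst q \<in> g" using that by auto
      then have "\<rho> (semidirect_bracket br \<phi> p q) $$ (i, j)
          = (\<rho> p * \<rho> q) $$ (i, j) - (\<rho> q * \<rho> p) $$ (i, j)"
        unfolding mult[OF ij] using ij by (simp add: \<rho>_def semidirect_bracket_def Madd M)
      then show "\<rho> (semidirect_bracket br \<phi> p q) $$ (i, j) = (\<rho> p * \<rho> q - \<rho> q * \<rho> p) $$ (i, j)"
        using ij by (simp add: \<rho>_def)
    qed (simp_all add: \<rho>_def)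
    moreover have "\<rho> (p + q) = \<rho> p + \<rho> q" "\<rho> (c *\<^sub>R p) = c \<cdot>\<^sub>m \<rho> p"
      if "p \<in> g \<times> UNIV" "q \<in> g \<times> UNIV" for p q c
      using that by (auto simp: \<rho>_def Madd intro!: eq_matI)
    ultimately show "\<exists>\<rho>. faithful_matrix_rep (g \<times> UNIV) (semidirect_bracket br \<phi>) 6 \<rho>"
      unfolding faithful_matrix_rep_def by (intro exI[of _ \<rho>]) (auto simp: \<rho>_def)
  next
    fix N assume "\<exists>\<rho>. faithful_matrix_rep (g \<times> UNIV) (semidirect_bracket br \<phi>) N \<rho>"
    then obtain \<rho> where rep: "faithful_matrix_rep (g \<times> UNIV) (semidirect_bracket br \<phi>) N \<rho>"
      by blast
    have \<rho>: "\<rho> p \<in> carrier_mat N N" "\<rho> (p + q) = \<rho> p + \<rho> q" "\<rho> (c *\<^sub>R p) = c \<cdot>\<^sub>m \<rho> p"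
      "\<rho> (semidirect_bracket br \<phi> p q) = \<rho> p * \<rho> q - \<rho> q * \<rho> p"
      if "fst p \<in> g" "fst q \<in> g" for p q c
    proof -
      have "p \<in> g \<times> UNIV" "q \<in> g \<times> UNIV" using that by (simp_all add: mem_Times_iff)
      then show "\<rho> p \<in> carrier_mat N N" "\<rho> (p + q) = \<rho> p + \<rho> q" "\<rho> (c *\<^sub>R p) = c \<cdot>\<^sub>m \<rho> p"
        "\<rho> (semidirect_bracket br \<phi> p q) = \<rho> p * \<rho> q - \<rho> q * \<rho> p"
        using rep unfolding faithful_matrix_rep_def by blast+
    qed
    have inj: "inj_on \<rho> (g \<times> UNIV)" using rep by (simp add: faithful_matrix_rep_def)
    show "6 \<le> N"
    proof (rule ccontr)
      assume "\<not> 6 \<le> N"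
      then have N: "N \<le> CARD(5)" by simp
      define P where "P p = matrix_of_mat h N (\<rho> p)" for p
      have P: "P (p + q) = P p + P q" "P (c *\<^sub>R p) = c *\<^sub>R P p"
        "P (semidirect_bracket br \<phi> p q) = commutator (P p) (P q)"
        if "fst p \<in> g" "fst q \<in> g" for p q c
        using that \<rho>(1)[OF that] \<rho>(1)[OF that(2,1)]
        by (simp_all add: P_def \<rho>(2-4) commutator_def matrix_of_mat_arith[of _ N]
            matrix_of_mat_mult[OF h N])
      have "inj_on P (g \<times> UNIV)"
        unfolding P_def using \<rho>(1) inj
        by (intro comp_inj_on[of \<rho> _ "matrix_of_mat h N", unfolded o_def]
            inj_on_subset[OF inj_on_matrix_of_mat[OF h N]]) auto
      define S where "S x = P (x, 0)" for x
      define R where "R v = P (0, v)" for v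
      show False
      proof (rule no_rep_on_real_5[of g \<phi> R S])
        show "linear (\<phi> x)" if "x \<in> g" for x using that by (rule lin)
        show "U = {0} \<or> U = UNIV"
          if "subspace U" "\<And>x u. x \<in> g \<Longrightarrow> u \<in> U \<Longrightarrow> \<phi> x u \<in> U" for U
          using irred that unfolding irreducible_lie_rep_def by blast
        show "\<exists>x\<in>g. \<exists>v. \<phi> x v \<noteq> 0" by (rule nontriv)
        show "linear R"
        proof (rule linearI)
          show "R (v + w) = R v + R w" for v w
            using P(1)[of "(0, v)" "(0, w)"] g0 by (simp add: R_def)
          show "R (c *\<^sub>R v) = c *\<^sub>R R v" for c v
            using P(2)[of "(0, v)" "(0, v)" c] g0 by (simp add: R_def)
        qed
        show "inj R"
          using \<open>inj_on P _\<close> g0 by (auto simp: R_def inj_on_def)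
        show "R v ** R w = R w ** R v" for v w
        proof -
          \<comment> \<open>Scaling by 0 yields \<open>P 0 = 0\<close>, and the bracket of two
            elements of the ideal is 0.\<close>
          have "P (0 *\<^sub>R (0, v)) = 0 *\<^sub>R P (0, v)" using g0 by (intro P(2)[of _ "(0, v)"]) auto
          moreover have "P (semidirect_bracket br \<phi> (0, v) (0, w)) = commutator (R v) (R w)"
            using g0 by (simp add: P R_def)
          ultimately show ?thesis
            by (simp add: semidirect_bracket_def \<phi>0 br0[OF g0] commutator_def zero_prod_def)
        qed
        show "R (\<phi> x v) = commutator (S x) (R v)" if "x \<in> g" for x v
          using P(3)[of "(x, 0)" "(0, v)"] that g0
          by (simp add: semidirect_bracket_def R_def S_def br0 \<phi>0)
      qed
    qed
  qed
qed

section \<open>Simplicity of sl(2) and so(3)\<close>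

text \<open>Bracketing twice with the nilpotent \<open>X 0 1 0\<close> sends \<open>X a b c\<close>
  to \<open>-2c\<close> times that nilpotent. If \<open>c = 0\<close>, one bracket gives
  \<open>-2a\<close> times it, and if also \<open>a = 0\<close> the element is already a multiple.
  So a nonzero ideal contains \<open>X 0 1 0\<close>, which generates the rest.\<close>

lemma sl2_simple:
  assumes I: "subspace I" "I \<subseteq> sl2" and ideal: "\<And>x y. x \<in> sl2 \<Longrightarrow> y \<in> I \<Longrightarrow> commutator x y \<in> I"
  shows "I = {0} \<or> I = sl2"
proof -
  define X :: "real \<Rightarrow> real \<Rightarrow> real \<Rightarrow> real^2^2" where
    "X a b c = (\<chi> i j. if i = 1 then if j = 1 then a else b else if j = 1 then c else - a)" for a b c
  have ent: "X a b c $ 1 $ 1 = a" "X a b c $ 1 $ 2 = b" "X a b c $ 2 $ 1 = c" "X a b c $ 2 $ 2 = - a"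
    for a b c by (simp_all add: X_def)
  have Xmem: "X a b c \<in> sl2" for a b c by (simp add: sl2_iff ent)
  have XI: "A = X (A $ 1 $ 1) (A $ 1 $ 2) (A $ 2 $ 1)" if "A \<in> sl2" for A
    using that by (simp add: Finite_Cartesian_Product.vec_eq_iff forall_2 ent sl2_iff)
  have comm: "commutator (X a b c) (X a' b' c')
      = X (b * c' - b' * c) (2 * (a * b' - a' * b)) (2 * (c * a' - a * c'))" for a b c a' b' c'
    by (simp add: Finite_Cartesian_Product.vec_eq_iff forall_2 ent commutator_def
        matrix_matrix_mult_def sum_2 algebra_simps)
  have scale: "r *\<^sub>R X a b c = X (r * a) (r * b) (r * c)"
    and add: "X a b c + X a' b' c' = X (a + a') (b + b') (c + c')" for r a b c a' b' c'
    by (simp_all add: Finite_Cartesian_Product.vec_eq_iff forall_2 ent)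
  note mult = subspace_mem_multiple[OF I(1)]
  have full: "I = sl2" if e: "X 0 1 0 \<in> I"
  proof -
    have h: "X 1 0 0 \<in> I"
      by (rule mult[OF ideal[OF Xmem[of 0 0 1] e], of "- 1"]) (simp_all add: comm scale)
    have f: "X 0 0 1 \<in> I"
      by (rule mult[OF ideal[OF Xmem[of 0 0 1] h], of 2]) (simp_all add: comm scale)
    have "X a b c \<in> I" for a b c
      using subspace_add[OF I(1) subspace_scale[OF I(1) h, of a]
          subspace_add[OF I(1) subspace_scale[OF I(1) e, of b] subspace_scale[OF I(1) f, of c]]]
      by (simp add: scale add)
    then show ?thesis using I(2) XI by (metis subsetI subset_antisym)
  qed
  show ?thesis
  proof (cases "I = {0}")
    case False
    then obtain A where A: "A \<in> I" "A \<noteq> 0" using subspace_0[OF I(1)] by blast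
    obtain a b c where abc: "A = X a b c" using XI A I(2) by blast
    have "a \<noteq> 0 \<or> b \<noteq> 0 \<or> c \<noteq> 0"
      using A(2) by (auto simp: abc X_def Finite_Cartesian_Product.vec_eq_iff split: if_splits)
    note E1 = ideal[OF Xmem[of 0 1 0] A(1)[unfolded abc], unfolded comm]
    note E2 = ideal[OF Xmem[of 0 1 0] E1, unfolded comm]
    show ?thesis
    proof (cases "c = 0")
      case False
      then have "X 0 1 0 \<in> I"
        by - (rule mult[OF E2, of "- 2 * c"], simp_all add: scale)
      then show ?thesis using full by blast
    next
      case c: True
      show ?thesis
      proof (cases "a = 0")
        case False
        then have "X 0 1 0 \<in> I"
          by - (rule mult[OF E1, of "- 2 * a"], simp_all add: scale c)
        then show ?thesis using full by blast
      next
        case True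
        then have "X 0 1 0 \<in> I"
          using \<open>a \<noteq> 0 \<or> b \<noteq> 0 \<or> c \<noteq> 0\<close> c
          by - (rule mult[OF A(1)[unfolded abc], of b], simp_all add: scale)
        then show ?thesis using full by blast
      qed
    qed
  qed simp
qed

text \<open>\<open>X a b c\<close> is the matrix of the cross product with \<open>(a, b, c)\<close>,
  and the commutator becomes the cross product. Bracketing successively with two basis vectors
  isolates one coordinate, as in \<open>e2 x (e1 x (a, b, c)) = b e1\<close>; brackets then permute
  the basis cyclically.\<close>

lemma so3_simple:
  assumes I: "subspace I" "I \<subseteq> so3" and ideal: "\<And>x y. x \<in> so3 \<Longrightarrow> y \<in> I \<Longrightarrow> commutator x y \<in> I"
  shows "I = {0} \<or> I = so3"
proof -
  define X :: "real \<Rightarrow> real \<Rightarrow> real \<Rightarrow> real^3^3" where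
    "X a b c = (\<chi> i j. if i = 1 then if j = 1 then 0 else if j = 2 then - c else b
      else if i = 2 then if j = 1 then c else if j = 2 then 0 else - a
      else if j = 1 then - b else if j = 2 then a else 0)" for a b c
  have ent: "X a b c $ 1 $ 1 = 0" "X a b c $ 1 $ 2 = - c" "X a b c $ 1 $ 3 = b"
    "X a b c $ 2 $ 1 = c" "X a b c $ 2 $ 2 = 0" "X a b c $ 2 $ 3 = - a"
    "X a b c $ 3 $ 1 = - b" "X a b c $ 3 $ 2 = a" "X a b c $ 3 $ 3 = 0"
    for a b c by (simp_all add: X_def)
  have Xmem: "X a b c \<in> so3" for a b c by (simp add: so3_iff ent)
  have XI: "A = X (A $ 3 $ 2) (A $ 1 $ 3) (A $ 2 $ 1)" if "A \<in> so3" for A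
    using that by (simp add: Finite_Cartesian_Product.vec_eq_iff forall_3 ent so3_iff)
  have comm: "commutator (X a b c) (X a' b' c')
      = X (b * c' - c * b') (c * a' - a * c') (a * b' - b * a')" for a b c a' b' c'
    by (simp add: Finite_Cartesian_Product.vec_eq_iff forall_3 ent commutator_def
        matrix_matrix_mult_def sum_3 algebra_simps)
  have scale: "r *\<^sub>R X a b c = X (r * a) (r * b) (r * c)"
    and add: "X a b c + X a' b' c' = X (a + a') (b + b') (c + c')" for r a b c a' b' c'
    by (simp_all add: Finite_Cartesian_Product.vec_eq_iff forall_3 ent)
  note mult = subspace_mem_multiple[OF I(1)]
  have cyc: "X 0 1 0 \<in> I" if "X 1 0 0 \<in> I"
    by (rule mult[OF ideal[OF Xmem[of 0 0 1] that], of 1]) (simp_all add: comm)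
  have cyc2: "X 0 0 1 \<in> I" if "X 0 1 0 \<in> I"
    by (rule mult[OF ideal[OF Xmem[of 1 0 0] that], of 1]) (simp_all add: comm)
  have cyc3: "X 1 0 0 \<in> I" if "X 0 0 1 \<in> I"
    by (rule mult[OF ideal[OF Xmem[of 0 1 0] that], of 1]) (simp_all add: comm)
  have full: "I = so3" if "X 1 0 0 \<in> I"
  proof -
    have "X a b c \<in> I" for a b c
      using subspace_add[OF I(1) subspace_scale[OF I(1) that, of a]
          subspace_add[OF I(1) subspace_scale[OF I(1) cyc[OF that], of b]
            subspace_scale[OF I(1) cyc2[OF cyc[OF that]], of c]]]
      by (simp add: scale add)
    then show ?thesis using I(2) XI by (metis subsetI subset_antisym)
  qed
  show ?thesis
  proof (cases "I = {0}")
    case False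
    then obtain A where A: "A \<in> I" "A \<noteq> 0" using subspace_0[OF I(1)] by blast
    obtain a b c where abc: "A = X a b c" using XI A I(2) by blast
    have "a \<noteq> 0 \<or> b \<noteq> 0 \<or> c \<noteq> 0"
      using A(2) by (auto simp: abc X_def Finite_Cartesian_Product.vec_eq_iff split: if_splits)
    note x = ideal[OF Xmem[of 0 1 0] ideal[OF Xmem[of 1 0 0] A(1)[unfolded abc]], unfolded comm]
    note y = ideal[OF Xmem[of 0 0 1] ideal[OF Xmem[of 0 1 0] A(1)[unfolded abc]], unfolded comm]
    note z = ideal[OF Xmem[of 1 0 0] ideal[OF Xmem[of 0 0 1] A(1)[unfolded abc]], unfolded comm]
    have "X 1 0 0 \<in> I" if "b \<noteq> 0"
      by (rule mult[OF x, of b]) (simp_all add: scale that)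
    moreover have "X 0 1 0 \<in> I" if "c \<noteq> 0"
      by (rule mult[OF y, of c]) (simp_all add: scale that)
    moreover have "X 0 0 1 \<in> I" if "a \<noteq> 0"
      by (rule mult[OF z, of a]) (simp_all add: scale that)
    ultimately show ?thesis
      using full cyc2 cyc3 \<open>a \<noteq> 0 \<or> b \<noteq> 0 \<or> c \<noteq> 0\<close> by blast
  qed simp
qed

theorem mainTheorem4:
  fixes \<phi> :: "real^3^3 \<Rightarrow> real^5 \<Rightarrow> real^5"
    and \<psi> :: "real^2^2 \<Rightarrow> real^5 \<Rightarrow> real^5"
  assumes "irreducible_lie_rep so3 commutator \<phi>"
    and "irreducible_lie_rep sl2 commutator \<psi>"
  shows "mu (so3 \<times> (UNIV :: (real^5) set)) (semidirect_bracket commutator \<phi>) = 6 \<and>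
         mu (sl2 \<times> (UNIV :: (real^5) set)) (semidirect_bracket commutator \<psi>) = 6"
  using mu_semidirect_eq_6[OF lie_algebra_so3 so3_simple assms(1)]
    mu_semidirect_eq_6[OF lie_algebra_sl2 sl2_simple assms(2)] by blast

end
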